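(* The infimum of the quantities $\frac{\mathrm{diam}(P)}{g(P)}$ over the family of all monostable convex polyhedra $P \subset \mathbb{R}^3$ is $\frac{1}{\pi}$.
   Context: A convex body is a compact, convex set with nonempty interior; a convex polyhedron is a convex body in $\mathbb{R}^3$ that is the convex hull of finitely many points. For a convex body $K\subset \mathbb{R}^3$, $\mathrm{diam}(K)$ is its diameter, and $g(K)$ is its girth: the minimum perimeter of an orthogonal projection of $K$ onto a plane. The center of mass of $P$ (with uniform density) is $c(P)=\frac{1}{\mathrm{vol}(P)}\int_{P} x\,dv$, where $v$ is 3-dimensional Lebesgue measure. A point $q \in \mathrm{bd}(P)$ is an equilibrium point of $P$ if the plane through $q$ orthogonal to $q-c(P)$ supports $P$. A stable point of a convex polyhedron $P$ is an equilibrium point lying in the relative interior of a (2-dimensional) face of $P$. A convex polyhedron is monostable if it can rest in stable position (on a horizontal plane) only on one of its faces, i.e. if it has exactly one stable point. *)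

theory Defs
  imports "HOL-Analysis.Analysis"
begin

definition convex_body :: "'a::euclidean_space set \<Rightarrow> bool" where
  "convex_body K \<longleftrightarrow> compact K \<and> convex K \<and> interior K \<noteq> {}"

definition convex_polyhedron :: "(real^3) set \<Rightarrow> bool" where
  "convex_polyhedron P \<longleftrightarrow> convex_body P \<and> (\<exists>V. finite V \<and> P = convex hull V)"

(* Arc length: the supremum of the lengths of inscribed polygonal lines, where t 0 \<le> ... \<le> t n
   are the subdivision points. It is a real number, so it is meaningful for rectifiable curves only. *)
definition curve_length :: "(real \<Rightarrow> 'a::metric_space) \<Rightarrow> real" where
  "curve_length \<gamma> =
     Sup {(\<Sum>i<n. dist (\<gamma> (t i)) (\<gamma> (t (Suc i)))) | n (t :: nat \<Rightarrow> real).
            mono t \<and> range t \<subseteq> {0..1}}"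

(* The length of the boundary curve of a compact convex set Q with aff_dim Q = 2 (in any ambient
   space, whence rel_frontier). This curve is a rectifiable simple closed curve, and its length
   does not depend on the parametrisation selected by SOME. *)
definition perimeter :: "'a::euclidean_space set \<Rightarrow> real" where
  "perimeter Q =
     curve_length (SOME \<gamma>. simple_path \<gamma> \<and> pathfinish \<gamma> = pathstart \<gamma> \<and> path_image \<gamma> = rel_frontier Q)"

(* closest_point H is the orthogonal projection onto the plane H. For a convex body K the
   infimum is attained, so it is the minimum perimeter. *)
definition girth :: "(real^3) set \<Rightarrow> real" where
  "girth K = Inf {perimeter (closest_point H ` K) | H. affine H \<and> aff_dim H = 2}"

definition center_of_mass :: "'a::euclidean_space set \<Rightarrow> 'a" where
  "center_of_mass P = (1 / measure lborel P) *\<^sub>R (LINT x:P|lborel. x)"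

(* The hyperplane {x. a \<bullet> x = b} supports S. *)
definition supports :: "'a::euclidean_space \<Rightarrow> real \<Rightarrow> 'a set \<Rightarrow> bool" where
  "supports a b S \<longleftrightarrow> a \<noteq> 0 \<and> S \<inter> {x. a \<bullet> x = b} \<noteq> {} \<and>
     (S \<subseteq> {x. a \<bullet> x \<le> b} \<or> S \<subseteq> {x. a \<bullet> x \<ge> b})"

definition equilibrium_point :: "(real^3) set \<Rightarrow> real^3 \<Rightarrow> bool" where
  "equilibrium_point P q \<longleftrightarrow> q \<in> frontier P \<and>
     supports (q - center_of_mass P) ((q - center_of_mass P) \<bullet> q) P"

definition stable_point :: "(real^3) set \<Rightarrow> real^3 \<Rightarrow> bool" where
  "stable_point P q \<longleftrightarrow> equilibrium_point P q \<and>
     (\<exists>F. F face_of P \<and> aff_dim F = 2 \<and> q \<in> rel_interior F)"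

definition monostable :: "(real^3) set \<Rightarrow> bool" where
  "monostable P \<longleftrightarrow> convex_polyhedron P \<and> (\<exists>!q. stable_point P q)"

end

theory Submission
  imports Defs "HOL-Complex_Analysis.Contour_Integration"
begin

text \<open>
  Lower bound. By Cauchy's formula the length of a vector \<open>e\<close> in a plane is half the integral of
  \<open>\<bar>e \<bullet> u\<bar>\<close> over the unit vectors \<open>u\<close> of a half circle in that plane. Summed over the edges of
  a polygon inscribed in the boundary curve of a planar convex body, the integrand becomes the variation
  of a linear functional along the curve. A functional takes each value strictly between its
  extremes at no more than two boundary points, so this variation is at most twice the width in
  direction \<open>u\<close>, and hence at most twice the diameter. Every projection of a body therefore has perimeter
  at most \<open>pi\<close> times the diameter of the body. Read in the other direction, the formula shows that
  every projection of a body that contains a ball of radius \<open>r\<close> has perimeter at least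
  \<open>2 * pi * r\<close>. Both bounds are in \<open>girth_bounds\<close>.

  Sharpness. It remains to find monostable polyhedra between the balls of radius \<open>1\<close> and
  \<open>1 + \<delta>\<close>. Let \<open>P = {x. \<forall>i\<in>I. a i \<bullet> x \<le> h i}\<close> with unit normals \<open>a i\<close> have its center of mass
  at the origin. A stable point on face \<open>i\<close> can only be the foot \<open>h i *\<^sub>R a i\<close> of the perpendicular
  from the origin, and this foot is cut off as soon as some \<open>j\<close> satisfies
  \<open>h j < h i * (a i \<bullet> a j)\<close>: the polyhedron rolls from face \<open>i\<close> towards face \<open>j\<close>
  (\<open>monostable_if_all_but_one_face_roll\<close>). The normals used here form a grid with angular mesh of
  order \<open>1 / N\<close>, and every normal rolls down an arc to a fixed great circle \<open>G\<close> and then along \<open>G\<close> to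
  the bottom. One step costs a factor \<open>1 + O(1 / N\<^sup>2)\<close> in height, and a path has at most
  \<open>2 * N\<close> steps, so the heights tend to \<open>1\<close>.

  The remaining difficulty is to put the center of mass at the origin. Multiplying the heights of all
  normals of an arc that do not lie on \<open>G\<close> by a common factor \<open>1 + \<epsilon>\<close> does not disturb the rolling.
  Doing this for the lower arcs makes \<open>P\<close> bottom-heavy and doing it for the upper arcs makes \<open>P\<close>
  top-heavy, for fixed \<open>\<epsilon>\<close> and large \<open>N\<close> (\<open>moment_sign\<close>). The vertical moment depends continuously
  on the heights, so some intermediate choice balances exactly; the two horizontal moments vanish
  by mirror symmetry.
\<close>

section \<open>Cauchy's formula and crossing numbers\<close>

lemma has_integral_abs_sin_shift:
  fixes \<psi> :: real
  assumes "0 \<le> \<psi>" "\<psi> \<le> pi"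
  shows "((\<lambda>t. \<bar>sin (t - \<psi>)\<bar>) has_integral 2) {0..pi}"
proof -
  have "((\<lambda>t. - sin (t - \<psi>)) has_integral (cos (\<psi> - \<psi>) - cos (0 - \<psi>))) {0..\<psi>}"
    using assms by (intro fundamental_theorem_of_calculus)
      (auto intro!: derivative_eq_intros simp flip: has_real_derivative_iff_has_vector_derivative)
  then have "((\<lambda>t. - sin (t - \<psi>)) has_integral (1 - cos \<psi>)) {0..\<psi>}" by simp
  then have "((\<lambda>t. \<bar>sin (t - \<psi>)\<bar>) has_integral (1 - cos \<psi>)) {0..\<psi>}"
  proof (rule has_integral_eq[rotated])
    fix x assume "x \<in> {0..\<psi>}"
    then have "sin (\<psi> - x) \<ge> 0" using assms by (intro sin_ge_zero) auto
    then show "- sin (x - \<psi>) = \<bar>sin (x - \<psi>)\<bar>" using sin_minus[of "\<psi> - x"] by simp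
  qed
  moreover have "((\<lambda>t. sin (t - \<psi>)) has_integral (- cos (pi - \<psi>) - (- cos (\<psi> - \<psi>)))) {\<psi>..pi}"
    using assms by (intro fundamental_theorem_of_calculus)
      (auto intro!: derivative_eq_intros simp flip: has_real_derivative_iff_has_vector_derivative)
  then have "((\<lambda>t. sin (t - \<psi>)) has_integral (1 + cos \<psi>)) {\<psi>..pi}" by (simp add: add.commute)
  then have "((\<lambda>t. \<bar>sin (t - \<psi>)\<bar>) has_integral (1 + cos \<psi>)) {\<psi>..pi}"
  proof (rule has_integral_eq[rotated])
    fix x assume "x \<in> {\<psi>..pi}"
    then have "sin (x - \<psi>) \<ge> 0" using assms by (intro sin_ge_zero) auto
    then show "sin (x - \<psi>) = \<bar>sin (x - \<psi>)\<bar>" by simp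
  qed
  ultimately have "((\<lambda>t. \<bar>sin (t - \<psi>)\<bar>) has_integral ((1 - cos \<psi>) + (1 + cos \<psi>))) {0..pi}"
    using assms by (intro has_integral_combine[of 0 \<psi> pi]) auto
  then show ?thesis by simp
qed

text \<open>
  This is Cauchy's formula in coordinates: the sinusoid is a shifted sine of amplitude
  \<open>sqrt (a\<^sup>2 + b\<^sup>2)\<close>, and \<open>\<bar>sin\<bar>\<close> has integral \<open>2\<close> over each period of length \<open>pi\<close>.
\<close>

lemma has_integral_abs_sinusoid:
  fixes a b :: real
  shows "((\<lambda>t. \<bar>a * cos t + b * sin t\<bar>) has_integral 2 * sqrt (a\<^sup>2 + b\<^sup>2)) {0..pi}"
proof (cases "a = 0 \<and> b = 0")
  case True
  then show ?thesis by simp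
next
  case False
  define r where "r = sqrt (a\<^sup>2 + b\<^sup>2)"
  \<comment> \<open>the sign keeps the phase \<open>\<psi>\<close> in \<open>{0..pi}\<close>\<close>
  define \<sigma> :: real where "\<sigma> = (if a \<le> 0 then 1 else -1)"
  have r: "r > 0" "r\<^sup>2 = a\<^sup>2 + b\<^sup>2" using False by (auto simp: r_def sum_power2_gt_zero_iff)
  have "0 \<le> - \<sigma> * a / r" using r by (auto simp: \<sigma>_def divide_le_0_iff)
  moreover have "(\<sigma> * b / r)\<^sup>2 + (- \<sigma> * a / r)\<^sup>2 = 1"
    using r by (simp add: \<sigma>_def power_divide flip: add_divide_distrib) (auto simp: add.commute)
  ultimately obtain \<psi> where \<psi>: "0 \<le> \<psi>" "\<psi> \<le> pi" "\<sigma> * b / r = cos \<psi>" "- \<sigma> * a / r = sin \<psi>"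
    using sincos_total_pi by metis
  have "\<bar>a * cos t + b * sin t\<bar> = r * \<bar>sin (t - \<psi>)\<bar>" for t
  proof -
    have "sin (t - \<psi>) = \<sigma> * (a * cos t + b * sin t) / r"
      using r by (simp add: sin_diff flip: \<psi>(3,4)) (simp add: field_simps)
    then show ?thesis using r by (simp add: abs_mult \<sigma>_def)
  qed
  then show ?thesis
    using has_integral_mult_right[OF has_integral_abs_sin_shift[OF \<psi>(1,2)], of r]
    by (simp add: r_def mult.commute)
qed

text \<open>
  The argument behind Banach's indicatrix theorem. Each summand is the length of the interval of
  values between \<open>f (t i)\<close> and \<open>f (t (Suc i))\<close>, and by the intermediate value theorem \<open>f\<close> crosses
  every such value between \<open>t i\<close> and \<open>t (Suc i)\<close>. A value therefore lies in at most \<open>k\<close> of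
  these intervals. Crossings are counted in the open interval \<open>{0<..<1}\<close> because a closed path
  is injective only there.
\<close>

lemma sum_abs_diff_le_crossings:
  fixes f :: "real \<Rightarrow> real"
  assumes cont: "continuous_on {0..1} f"
    and cross: "\<And>s x y. x \<in> {0..1} \<Longrightarrow> y \<in> {0..1} \<Longrightarrow> f x < s \<Longrightarrow> s < f y \<Longrightarrow>
                  finite {t\<in>{0<..<1}. f t = s} \<and> card {t\<in>{0<..<1}. f t = s} \<le> k"
    and d: "\<And>x y. x \<in> {0..1} \<Longrightarrow> y \<in> {0..1} \<Longrightarrow> f x - f y \<le> d"
    and t: "mono t" "range t \<subseteq> {0..1}"
  shows "(\<Sum>i<n. \<bar>f (t (Suc i)) - f (t i)\<bar>) \<le> real k * d"
proof -
  have tin: "t i \<in> {0..1}" for i using t(2) by blast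
  obtain m where m: "m \<in> {0..1}" "\<And>x. x \<in> {0..1} \<Longrightarrow> f m \<le> f x"
    using continuous_attains_inf[of "{0..1::real}" f] cont by auto
  obtain M where M: "M \<in> {0..1}" "\<And>x. x \<in> {0..1} \<Longrightarrow> f x \<le> f M"
    using continuous_attains_sup[of "{0..1::real}" f] cont by auto
  define J where "J i = {min (f (t i)) (f (t (Suc i))) <..< max (f (t i)) (f (t (Suc i)))}" for i
  have count: "(\<Sum>i<n. indicat_real (J i) s) \<le> real k * indicat_real {f m..f M} s" for s
  proof -
    define A where "A = {i\<in>{..<n}. s \<in> J i}"
    have card: "(\<Sum>i<n. indicat_real (J i) s) = real (card A)"
      by (simp add: A_def indicator_def sum.If_cases Int_def)
    show ?thesis
    proof (cases "A = {}")
      case True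
      then show ?thesis unfolding card by simp
    next
      case False
      then obtain i where i: "s \<in> J i" by (auto simp: A_def)
      have s: "f m \<le> s" "s \<le> f M"
        using i m(2)[OF tin, of i] m(2)[OF tin, of "Suc i"] M(2)[OF tin, of i] M(2)[OF tin, of "Suc i"]
        by (auto simp: J_def min_def max_def split: if_splits)
      have cr: "finite {t\<in>{0<..<1}. f t = s} \<and> card {t\<in>{0<..<1}. f t = s} \<le> k"
        using i cross[OF tin tin, of i s "Suc i"] cross[OF tin tin, of "Suc i" s i]
        by (auto simp: J_def min_def max_def split: if_splits)
      have "\<exists>x. t i < x \<and> x < t (Suc i) \<and> f x = s" if "s \<in> J i" for i
      proof -
        have le: "t i \<le> t (Suc i)" using t(1) by (simp add: monoD)
        have c: "continuous_on {t i..t (Suc i)} f"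
          by (rule continuous_on_subset[OF cont]) (use tin[of i] tin[of "Suc i"] in auto)
        have "\<exists>x. t i \<le> x \<and> x \<le> t (Suc i) \<and> f x = s"
          using that IVT'[OF _ _ le c, of s] IVT2'[OF _ _ le c, of s]
          by (auto simp: J_def min_def max_def split: if_splits)
        then obtain x where x: "t i \<le> x" "x \<le> t (Suc i)" "f x = s" by auto
        moreover have "x \<noteq> t i" "x \<noteq> t (Suc i)"
          using that x(3) by (auto simp: J_def min_def max_def split: if_splits)
        ultimately show ?thesis by (intro exI[of _ x]) auto
      qed
      then have "\<forall>i. \<exists>x. s \<in> J i \<longrightarrow> t i < x \<and> x < t (Suc i) \<and> f x = s" by blast
      from choice[OF this] obtain \<tau>
        where "\<forall>i. s \<in> J i \<longrightarrow> t i < \<tau> i \<and> \<tau> i < t (Suc i) \<and> f (\<tau> i) = s" ..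
      then have \<tau>: "t i < \<tau> i \<and> \<tau> i < t (Suc i) \<and> f (\<tau> i) = s" if "s \<in> J i" for i
        using that by simp
      have sep: "\<tau> i < \<tau> j" if "s \<in> J i" "s \<in> J j" "i < j" for i j
      proof -
        have "t (Suc i) \<le> t j" by (rule monoD[OF t(1)]) (use that in simp)
        then show ?thesis using \<tau>[of i] \<tau>[of j] that by linarith
      qed
      have "inj_on \<tau> A"
      proof (rule linorder_inj_onI)
        fix i j assume "i < j" "i \<in> A" "j \<in> A"
        then show "\<tau> i \<noteq> \<tau> j" using sep[of i j] by (auto simp: A_def)
      qed auto
      moreover have "\<tau> ` A \<subseteq> {t\<in>{0<..<1}. f t = s}"
      proof safe
        fix i assume "i \<in> A"
        then have "t i < \<tau> i \<and> \<tau> i < t (Suc i) \<and> f (\<tau> i) = s" using \<tau> by (auto simp: A_def)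
        then show "\<tau> i \<in> {0<..<1}" "f (\<tau> i) = s" using tin[of i] tin[of "Suc i"] by auto
      qed
      ultimately have "card A \<le> card {t\<in>{0<..<1}. f t = s}" using cr by (intro card_inj_on_le) auto
      then show ?thesis using cr s unfolding card by (simp add: indicator_def)
    qed
  qed
  have "(\<Sum>i<n. \<bar>f (t (Suc i)) - f (t i)\<bar>) = (\<Sum>i<n. measure lborel (J i))"
    by (intro sum.cong) (auto simp: J_def)
  also have "\<dots> = (\<integral>s. (\<Sum>i<n. indicat_real (J i) s) \<partial>lborel)"
    by (subst Bochner_Integration.integral_sum) (auto simp: J_def emeasure_lborel_Ioo)
  also have "\<dots> \<le> (\<integral>s. real k * indicat_real {f m..f M} s \<partial>lborel)"
    using m(2)[OF M(1)] by (intro integral_mono count) (auto simp: J_def intro!: integrable_real_indicator)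
  also have "\<dots> = real k * (f M - f m)" using m(2)[OF M(1)] by simp
  also have "\<dots> \<le> real k * d" using d[OF M(1) m(1)] by (intro mult_left_mono) auto
  finally show ?thesis .
qed

text \<open>
  A closed walk has to go from \<open>g i\<close> to \<open>g j\<close> and back.
\<close>

lemma sum_abs_diff_closed_ge:
  fixes g :: "nat \<Rightarrow> real"
  assumes "g n = g 0" "i \<le> n" "j \<le> n"
  shows "2 * \<bar>g i - g j\<bar> \<le> (\<Sum>l<n. \<bar>g (Suc l) - g l\<bar>)"
proof -
  have tele: "\<bar>g b - g a\<bar> \<le> (\<Sum>l=a..<b. \<bar>g (Suc l) - g l\<bar>)" if "a \<le> b" for a b
    using sum_abs[of "\<lambda>l. g (Suc l) - g l" "{a..<b}"] sum_Suc_diff'[OF that, of g] by simp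
  have *: "2 * \<bar>g i - g j\<bar> \<le> (\<Sum>l<n. \<bar>g (Suc l) - g l\<bar>)" if "i \<le> j" "j \<le> n" for i j
  proof -
    have "(\<Sum>l<n. \<bar>g (Suc l) - g l\<bar>) = (\<Sum>l=0..<i. \<bar>g (Suc l) - g l\<bar>)
       + (\<Sum>l=i..<j. \<bar>g (Suc l) - g l\<bar>) + (\<Sum>l=j..<n. \<bar>g (Suc l) - g l\<bar>)"
      using that by (simp add: sum.atLeastLessThan_concat flip: atLeast0LessThan)
    moreover have "\<bar>g i - g 0\<bar> \<le> (\<Sum>l=0..<i. \<bar>g (Suc l) - g l\<bar>)" by (rule tele) simp
    moreover have "\<bar>g i - g j\<bar> \<le> \<bar>g i - g 0\<bar> + \<bar>g n - g j\<bar>" using assms(1) by simp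
    moreover have "\<bar>g i - g j\<bar> = \<bar>g j - g i\<bar>" by simp
    moreover note tele[OF that(1)] tele[OF that(2)]
    ultimately show ?thesis by argo
  qed
  show ?thesis using *[of i j] *[of j i] assms by (cases "i \<le> j") (auto simp: abs_minus_commute)
qed

text \<open>
  The hypothesis \<open>flat\<close> says that \<open>Q\<close> lies in a plane with orthonormal directions \<open>u\<close> and \<open>v\<close>, so a
  level set of \<open>\<lambda>z. z \<bullet> u\<close> in \<open>Q\<close> lies on a line in direction \<open>v\<close>. For a value strictly between two
  attained ones this line passes through a relative interior point \<open>r\<close>, and on each side of \<open>r\<close>
  it meets the relative frontier at most once: of two such points the nearer one would be relatively
  interior.
\<close>

lemma rel_frontier_level_le_2:
  fixes Q :: "'a::euclidean_space set"
  assumes Q: "convex Q" "closed Q"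
    and flat: "\<And>x y. x \<in> Q \<Longrightarrow> y \<in> Q \<Longrightarrow> x - y = ((x - y) \<bullet> u) *\<^sub>R u + ((x - y) \<bullet> v) *\<^sub>R v"
    and x: "x \<in> Q" "x \<bullet> u < s" and y: "y \<in> Q" "s < y \<bullet> u"
  shows "finite {z \<in> rel_frontier Q. z \<bullet> u = s} \<and> card {z \<in> rel_frontier Q. z \<bullet> u = s} \<le> 2"
proof -
  let ?L = "{z \<in> rel_frontier Q. z \<bullet> u = s}"
  have cl: "closure (rel_interior Q) = Q" using Q by (simp add: convex_closure_rel_interior)
  have dense: "\<exists>z\<in>rel_interior Q. z \<in> U" if "open U" "w \<in> U" "w \<in> Q" for U w
    using that cl open_Int_closure_eq_empty[of U "rel_interior Q"] by blast
  obtain x' where x': "x' \<in> rel_interior Q" "u \<bullet> x' < s"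
    using dense[of "{z. u \<bullet> z < s}" x] x open_halfspace_lt[of u s] by (auto simp: open_halfspace_lt inner_commute[of u])
  obtain y' where y': "y' \<in> rel_interior Q" "s < u \<bullet> y'"
    using dense[of "{z. s < u \<bullet> z}" y] y open_halfspace_gt[of s u] by (auto simp: open_halfspace_gt inner_commute[of u])
  obtain r where r: "r \<in> rel_interior Q" "u \<bullet> r = s"
    using connected_ivt_hyperplane[of "rel_interior Q" x' y' u s] x' y' Q
    by (force intro: convex_connected convex_rel_interior)
  have rQ: "r \<in> Q" using r rel_interior_subset by blast
  have z: "z \<in> Q" "z \<notin> rel_interior Q" "z = r + ((z - r) \<bullet> v) *\<^sub>R v" if "z \<in> ?L" for z
  proof -
    show "z \<in> Q" "z \<notin> rel_interior Q" using that Q by (auto simp: rel_frontier_def)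
    then show "z = r + ((z - r) \<bullet> v) *\<^sub>R v"
      using flat[of z r] that rQ r by (simp add: inner_commute inner_diff_left inner_diff_right algebra_simps)
  qed
  have nz: "(z - r) \<bullet> v \<noteq> 0" if "z \<in> ?L" for z using z[OF that] r by auto
  have key: False if zw: "z \<in> ?L" "w \<in> ?L" "sgn ((z - r) \<bullet> v) = sgn ((w - r) \<bullet> v)"
      "\<bar>(z - r) \<bullet> v\<bar> < \<bar>(w - r) \<bullet> v\<bar>" for z w
  proof -
    define a where "a = (z - r) \<bullet> v"
    define b where "b = (w - r) \<bullet> v"
    define c where "c = a / b"
    have ab: "a \<noteq> 0" "b \<noteq> 0" "sgn a = sgn b" "\<bar>a\<bar> < \<bar>b\<bar>" using zw nz by (auto simp: a_def b_def)
    have c: "0 < c" "c < 1" using ab by (auto simp: c_def sgn_if zero_less_divide_iff divide_less_eq split: if_splits)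
    have v0: "v \<noteq> 0" using nz[OF zw(1)] by auto
    have zr: "z = r + a *\<^sub>R v" and wr: "w = r + b *\<^sub>R v" using z(3) zw by (auto simp: a_def b_def)
    have "z = (1 - c) *\<^sub>R r + c *\<^sub>R w" using ab by (simp add: zr wr c_def algebra_simps)
    moreover have "r \<noteq> w" using ab v0 by (simp add: wr)
    ultimately have "z \<in> open_segment r w" using c by (auto simp: in_segment)
    moreover have "open_segment r w \<subseteq> rel_interior Q"
      using rel_interior_closure_convex_segment[OF Q(1) r(1)] z(1)[OF zw(2)] closure_subset by blast
    ultimately show False using z(2)[OF zw(1)] by blast
  qed
  have "inj_on (\<lambda>z. sgn ((z - r) \<bullet> v)) ?L"
  proof (rule inj_onI)
    fix z w assume zw: "z \<in> ?L" "w \<in> ?L" "sgn ((z - r) \<bullet> v) = sgn ((w - r) \<bullet> v)"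
    have "\<bar>(z - r) \<bullet> v\<bar> = \<bar>(w - r) \<bullet> v\<bar>"
      using key[OF zw] key[OF zw(2,1) zw(3)[symmetric]] by (meson linorder_neqE)
    then have "(z - r) \<bullet> v = (w - r) \<bullet> v" using zw(3) by (metis mult_sgn_abs)
    then show "z = w" using z(3)[OF zw(1)] z(3)[OF zw(2)] by metis
  qed
  moreover have "(\<lambda>z. sgn ((z - r) \<bullet> v)) ` ?L \<subseteq> {-1, 1}" using nz by (auto simp: sgn_if)
  ultimately show ?thesis
    using inj_on_finite[of "\<lambda>z. sgn ((z - r) \<bullet> v)" ?L "{-1, 1}"]
      card_inj_on_le[of "\<lambda>z. sgn ((z - r) \<bullet> v)" ?L "{-1, 1}"] by simp
qed

section \<open>The perimeter of planar convex bodies\<close>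

locale orthonormal_pair =
  fixes e1 e2 :: "'a::euclidean_space"
  assumes unit: "e1 \<bullet> e1 = 1" "e2 \<bullet> e2 = 1" and orth: "e1 \<bullet> e2 = 0"
begin

definition dir :: "real \<Rightarrow> 'a" where
  "dir \<theta> = cos \<theta> *\<^sub>R e1 + sin \<theta> *\<^sub>R e2"

text \<open>
  Membership of \<open>S\<close> in a translate of the span of \<open>e1\<close> and \<open>e2\<close>, phrased through differences so
  that no base point has to be carried along.
\<close>

definition flat :: "'a set \<Rightarrow> bool" where
  "flat S \<longleftrightarrow> (\<forall>x\<in>S. \<forall>y\<in>S. x - y = ((x - y) \<bullet> e1) *\<^sub>R e1 + ((x - y) \<bullet> e2) *\<^sub>R e2)"

lemma orth': "e2 \<bullet> e1 = 0" using orth by (simp add: inner_commute)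

lemma dir_unit: "dir \<theta> \<bullet> dir \<theta> = 1"
  by (simp add: dir_def inner_add_left inner_add_right unit orth orth' flip: power2_eq_square)

lemma norm_dir [simp]: "norm (dir \<theta>) = 1"
  by (simp add: norm_eq_sqrt_inner dir_unit)

lemma inner_dir_le: "\<bar>x \<bullet> dir \<theta>\<bar> \<le> norm x"
  using Cauchy_Schwarz_ineq2[of x "dir \<theta>"] by simp

lemma expand_rotated:
  assumes d: "d = (d \<bullet> e1) *\<^sub>R e1 + (d \<bullet> e2) *\<^sub>R e2"
  shows "d = (d \<bullet> dir \<theta>) *\<^sub>R dir \<theta> + (d \<bullet> dir (\<theta> + pi / 2)) *\<^sub>R dir (\<theta> + pi / 2)"
proof -
  define a b where "a = d \<bullet> e1" and "b = d \<bullet> e2"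
  let ?c = "cos \<theta>" and ?s = "sin \<theta>"
  have dir2: "dir (\<theta> + pi / 2) = - ?s *\<^sub>R e1 + ?c *\<^sub>R e2"
    by (simp add: dir_def cos_add sin_add)
  have ip: "d \<bullet> dir \<theta> = a * ?c + b * ?s" "d \<bullet> dir (\<theta> + pi / 2) = b * ?c - a * ?s"
    unfolding dir2 by (simp_all add: dir_def inner_add_right inner_diff_right a_def b_def)
  have "(d \<bullet> dir \<theta>) *\<^sub>R dir \<theta> + (d \<bullet> dir (\<theta> + pi / 2)) *\<^sub>R dir (\<theta> + pi / 2)
     = ((a * ?c + b * ?s) * ?c - (b * ?c - a * ?s) * ?s) *\<^sub>R e1
       + ((a * ?c + b * ?s) * ?s + (b * ?c - a * ?s) * ?c) *\<^sub>R e2"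
    unfolding ip unfolding dir2 unfolding dir_def by (simp add: algebra_simps)
  also have "(a * ?c + b * ?s) * ?c - (b * ?c - a * ?s) * ?s = a * (?s\<^sup>2 + ?c\<^sup>2)"
    by algebra
  also have "(a * ?c + b * ?s) * ?s + (b * ?c - a * ?s) * ?c = b * (?s\<^sup>2 + ?c\<^sup>2)"
    by algebra
  finally show ?thesis using d by (simp add: a_def b_def)
qed

lemma norm_eq_integral:
  assumes d: "d = (d \<bullet> e1) *\<^sub>R e1 + (d \<bullet> e2) *\<^sub>R e2"
  shows "((\<lambda>\<theta>. \<bar>d \<bullet> dir \<theta>\<bar>) has_integral 2 * norm d) {0..pi}"
proof -
  have "d \<bullet> d = (d \<bullet> e1)\<^sup>2 + (d \<bullet> e2)\<^sup>2"
    by (subst (2) d) (simp add: inner_add_right power2_eq_square)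
  then have "norm d = sqrt ((d \<bullet> e1)\<^sup>2 + (d \<bullet> e2)\<^sup>2)" by (simp add: norm_eq_sqrt_inner)
  moreover have "d \<bullet> dir \<theta> = (d \<bullet> e1) * cos \<theta> + (d \<bullet> e2) * sin \<theta>" for \<theta>
    by (simp add: dir_def inner_add_right)
  ultimately show ?thesis using has_integral_abs_sinusoid[of "d \<bullet> e1" "d \<bullet> e2"] by simp
qed

lemma polygon_length_integral:
  assumes "flat S" "\<And>i. \<gamma> (t i) \<in> S"
  shows "((\<lambda>\<theta>. \<Sum>i<n. \<bar>\<gamma> (t (Suc i)) \<bullet> dir \<theta> - \<gamma> (t i) \<bullet> dir \<theta>\<bar>)
           has_integral 2 * (\<Sum>i<n. dist (\<gamma> (t i)) (\<gamma> (t (Suc i))))) {0..pi}"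
proof -
  have "((\<lambda>\<theta>. \<Sum>i<n. \<bar>(\<gamma> (t (Suc i)) - \<gamma> (t i)) \<bullet> dir \<theta>\<bar>)
           has_integral (\<Sum>i<n. 2 * norm (\<gamma> (t (Suc i)) - \<gamma> (t i)))) {0..pi}"
    using assms by (intro has_integral_sum norm_eq_integral) (auto simp: flat_def)
  then show ?thesis by (simp add: inner_diff_left sum_distrib_left dist_norm norm_minus_commute)
qed

text \<open>
  For each direction the linear functional along \<open>\<gamma>\<close> takes intermediate values at most twice,
  so its variation is at most twice the diameter; averaging over the directions gives the
  factor \<open>pi\<close>.
\<close>

lemma polygon_length_le:
  assumes Q: "convex Q" "compact Q" "flat Q"
    and \<gamma>: "simple_path \<gamma>" "path_image \<gamma> = rel_frontier Q"
    and t: "mono t" "range t \<subseteq> {0..1}"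
  shows "(\<Sum>i<n. dist (\<gamma> (t i)) (\<gamma> (t (Suc i)))) \<le> pi * diameter Q"
proof -
  have fr: "rel_frontier Q \<subseteq> Q"
    using Q(2) by (auto simp: rel_frontier_def compact_imp_closed closure_closed)
  have \<gamma>in: "\<gamma> x \<in> rel_frontier Q" if "x \<in> {0..1}" for x
    using that \<gamma>(2) by (auto simp: path_image_def)
  have tin: "t i \<in> {0..1}" for i using t(2) by blast
  have cont: "continuous_on {0..1} \<gamma>" using \<gamma>(1) by (simp add: simple_path_def path_def)
  have inj: "inj_on \<gamma> {0<..<1}" using simple_path_inj_on[OF \<gamma>(1)] .
  have var: "(\<Sum>i<n. \<bar>\<gamma> (t (Suc i)) \<bullet> dir \<theta> - \<gamma> (t i) \<bullet> dir \<theta>\<bar>) \<le> real 2 * diameter Q" for \<theta>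
  proof (rule sum_abs_diff_le_crossings[OF _ _ _ t])
    show "continuous_on {0..1} (\<lambda>x. \<gamma> x \<bullet> dir \<theta>)" using cont by (intro continuous_intros)
  next
    fix x y :: real assume "x \<in> {0..1}" "y \<in> {0..1}"
    then have "dist (\<gamma> x) (\<gamma> y) \<le> diameter Q"
      using \<gamma>in fr Q by (intro diameter_bounded_bound compact_imp_bounded) auto
    then show "\<gamma> x \<bullet> dir \<theta> - \<gamma> y \<bullet> dir \<theta> \<le> diameter Q"
      using inner_dir_le[of "\<gamma> x - \<gamma> y" \<theta>] by (simp add: inner_diff_left dist_norm)
  next
    fix s x y :: real
    assume xy: "x \<in> {0..1}" "y \<in> {0..1}" "\<gamma> x \<bullet> dir \<theta> < s" "s < \<gamma> y \<bullet> dir \<theta>"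
    have lev: "finite {z \<in> rel_frontier Q. z \<bullet> dir \<theta> = s} \<and> card {z \<in> rel_frontier Q. z \<bullet> dir \<theta> = s} \<le> 2"
    proof (rule rel_frontier_level_le_2[of Q "dir \<theta>" "dir (\<theta> + pi / 2)" "\<gamma> x" s "\<gamma> y"])
      fix a b assume "a \<in> Q" "b \<in> Q"
      then show "a - b = ((a - b) \<bullet> dir \<theta>) *\<^sub>R dir \<theta>
          + ((a - b) \<bullet> dir (\<theta> + pi / 2)) *\<^sub>R dir (\<theta> + pi / 2)"
        using Q(3) by (intro expand_rotated) (auto simp: flat_def)
    qed (use Q xy \<gamma>in fr compact_imp_closed in auto)
    have sub: "\<gamma> ` {t\<in>{0<..<1}. \<gamma> t \<bullet> dir \<theta> = s} \<subseteq> {z \<in> rel_frontier Q. z \<bullet> dir \<theta> = s}"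
      using \<gamma>in by auto
    have inj': "inj_on \<gamma> {t\<in>{0<..<1}. \<gamma> t \<bullet> dir \<theta> = s}"
      using inj by (rule inj_on_subset) auto
    show "finite {t\<in>{0<..<1}. \<gamma> t \<bullet> dir \<theta> = s} \<and> card {t\<in>{0<..<1}. \<gamma> t \<bullet> dir \<theta> = s} \<le> 2"
      using inj_on_finite[OF inj' sub] card_inj_on_le[OF inj' sub] lev by linarith
  qed
  have "2 * (\<Sum>i<n. dist (\<gamma> (t i)) (\<gamma> (t (Suc i)))) \<le> 2 * diameter Q * (pi - 0)"
  proof (rule has_integral_le)
    show "((\<lambda>\<theta>. \<Sum>i<n. \<bar>\<gamma> (t (Suc i)) \<bullet> dir \<theta> - \<gamma> (t i) \<bullet> dir \<theta>\<bar>)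
           has_integral 2 * (\<Sum>i<n. dist (\<gamma> (t i)) (\<gamma> (t (Suc i))))) {0..pi}"
      by (rule polygon_length_integral[OF Q(3)]) (use \<gamma>in fr tin in blast)
    show "((\<lambda>\<theta>. 2 * diameter Q) has_integral 2 * diameter Q * (pi - 0)) {0..pi}"
      using has_integral_const_real[of "2 * diameter Q" 0 pi] by (simp add: mult.commute)
  qed (use var in simp)
  then show ?thesis by (simp add: mult.commute)
qed

lemma curve_length_le:
  assumes Q: "convex Q" "compact Q" "flat Q"
    and \<gamma>: "simple_path \<gamma>" "path_image \<gamma> = rel_frontier Q"
  shows "curve_length \<gamma> \<le> pi * diameter Q"
  unfolding curve_length_def
proof (rule cSup_least)
  show "{\<Sum>i<n. dist (\<gamma> (t i)) (\<gamma> (t (Suc i))) |n t. mono t \<and> range t \<subseteq> {0..1}} \<noteq> {}"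
    by (auto intro!: exI[of _ "\<lambda>_. 0"] simp: mono_def)
qed (use polygon_length_le[OF assms] in blast)

text \<open>
  A sufficiently fine uniform partition comes close to the points of extreme position in all
  directions at once, whatever the order in which \<open>\<gamma>\<close> visits them. So for every direction the variation over this one polygon falls only slightly short of twice the width, and
  twice the width is at least \<open>4 * r\<close>.
\<close>

lemma curve_length_ge:
  assumes Q: "convex Q" "compact Q" "flat Q"
    and \<gamma>: "simple_path \<gamma>" "pathfinish \<gamma> = pathstart \<gamma>" "path_image \<gamma> = rel_frontier Q"
    and c: "c \<in> rel_interior Q" and disc: "\<And>a b. a\<^sup>2 + b\<^sup>2 \<le> r\<^sup>2 \<Longrightarrow> c + a *\<^sub>R e1 + b *\<^sub>R e2 \<in> Q"
    and r: "0 < r"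
  shows "2 * pi * r \<le> curve_length \<gamma>"
proof (rule field_le_epsilon)
  fix e :: real assume e: "0 < e"
  \<comment> \<open>\<open>\<eta>\<close> is the accuracy of the partition; it costs \<open>2 * pi * \<eta>\<close> in the final bound\<close>
  define \<eta> where "\<eta> = e / (2 * pi)"
  have \<eta>: "0 < \<eta>" using e by (simp add: \<eta>_def)
  have fr: "rel_frontier Q \<subseteq> Q"
    using Q(2) by (auto simp: rel_frontier_def compact_imp_closed closure_closed)
  have \<gamma>in: "\<gamma> x \<in> rel_frontier Q" if "x \<in> {0..1}" for x
    using that \<gamma>(3) by (auto simp: path_image_def)
  have cont: "continuous_on {0..1} \<gamma>" using \<gamma>(1) by (simp add: simple_path_def path_def)
  obtain \<delta> where \<delta>: "0 < \<delta>" "\<And>x y. x \<in> {0..1} \<Longrightarrow> y \<in> {0..1} \<Longrightarrow> dist y x < \<delta> \<Longrightarrow> dist (\<gamma> y) (\<gamma> x) < \<eta>"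
    using compact_uniformly_continuous[OF cont] \<eta> unfolding uniformly_continuous_on_def by (metis compact_Icc)
  obtain n :: nat where n: "1 / \<delta> < real n" using reals_Archimedean2 by blast
  have n0: "0 < real n" by (rule less_trans[OF _ n]) (use \<delta> in simp)
  define t where "t i = min 1 (real i / real n)" for i
  have "mono t" unfolding mono_def t_def by (intro allI impI min.mono divide_right_mono) auto
  moreover have "range t \<subseteq> {0..1}" by (auto simp: t_def)
  ultimately have t: "mono t" "range t \<subseteq> {0..1}" .
  have tin: "t i \<in> {0..1}" for i using t(2) by blast
  have near: "\<exists>i\<le>n. dist (\<gamma> (t i)) (\<gamma> x) < \<eta>" if "x \<in> {0..1}" for x
  proof -
    define i where "i = nat \<lfloor>x * n\<rfloor>"
    have i: "real i \<le> x * n" "x * n < real i + 1" using that n0 by (auto simp: i_def)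
    have xn: "x * n \<le> n" using that n0 by simp
    then have "real i \<le> real n" using i by linarith
    then have "i \<le> n" "t i = real i / n" using n0 by (auto simp: t_def)
    moreover have "\<bar>real i / n - x\<bar> < 1 / n"
    proof -
      have "real i / n - x = (real i - x * n) / n" using n0 by (simp add: field_simps)
      moreover have "\<bar>real i - x * n\<bar> < 1" using i by linarith
      ultimately show ?thesis using n0 by (simp add: divide_strict_right_mono)
    qed
    moreover have "1 / n < \<delta>" using n \<delta> n0 by (simp add: field_simps)
    ultimately show ?thesis using \<delta>(2)[OF that tin, of i] by (auto simp: dist_real_def)
  qed
  have far: "\<exists>i\<le>n. (\<gamma> (t i) - c) \<bullet> dir \<theta> > r - \<eta>" for \<theta>
  proof -
    have in': "c + s *\<^sub>R dir \<theta> \<in> Q" if "\<bar>s\<bar> \<le> r" for s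
    proof -
      have "(s * cos \<theta>)\<^sup>2 + (s * sin \<theta>)\<^sup>2 = s\<^sup>2 * ((sin \<theta>)\<^sup>2 + (cos \<theta>)\<^sup>2)"
        by algebra
      then have "(s * cos \<theta>)\<^sup>2 + (s * sin \<theta>)\<^sup>2 = s\<^sup>2" by simp
      also have "\<dots> \<le> r\<^sup>2" using that r by (simp add: abs_le_square_iff[symmetric])
      finally show ?thesis using disc[of "s * cos \<theta>" "s * sin \<theta>"] by (simp add: dir_def scaleR_add_right add.assoc)
    qed
    have "c + r *\<^sub>R dir \<theta> \<in> Q" using r by (intro in') auto
    moreover have "c \<in> Q" using c rel_interior_subset by blast
    ultimately have "(1 - 1 / r) *\<^sub>R c + (1 / r) *\<^sub>R (c + r *\<^sub>R dir \<theta>) \<in> affine hull Q"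
      using mem_affine[OF affine_affine_hull, of c Q "c + r *\<^sub>R dir \<theta>" "1 - 1/r" "1/r"]
      by (simp add: hull_inc)
    moreover have "(1 - 1 / r) *\<^sub>R c + (1 / r) *\<^sub>R (c + r *\<^sub>R dir \<theta>) = c + dir \<theta>"
      using r by (simp add: algebra_simps)
    ultimately have "c + dir \<theta> \<in> affine hull Q" by simp
    moreover have "dir \<theta> \<noteq> 0" using norm_dir[of \<theta>] by fastforce
    ultimately obtain d where d: "0 < d" "c + d *\<^sub>R dir \<theta> \<in> rel_frontier Q"
      using ray_to_rel_frontier[OF compact_imp_bounded[OF Q(2)] c] by metis
    have "r \<le> d"
    proof (rule ccontr)
      assume "\<not> r \<le> d"
      then have dr: "d < r" by simp
      have "c + d *\<^sub>R dir \<theta> = (1 - d / r) *\<^sub>R c + (d / r) *\<^sub>R (c + r *\<^sub>R dir \<theta>)"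
        using r by (simp add: algebra_simps)
      moreover have "c \<noteq> c + r *\<^sub>R dir \<theta>" using r \<open>dir \<theta> \<noteq> 0\<close> by simp
      moreover have "0 < d / r" "d / r < 1" using d r dr by auto
      ultimately have "c + d *\<^sub>R dir \<theta> \<in> open_segment c (c + r *\<^sub>R dir \<theta>)"
        unfolding in_segment by blast
      then have "c + d *\<^sub>R dir \<theta> \<in> rel_interior Q"
        using rel_interior_closure_convex_segment[OF Q(1) c, of "c + r *\<^sub>R dir \<theta>"]
          \<open>c + r *\<^sub>R dir \<theta> \<in> Q\<close> closure_subset by blast
      then show False using d by (simp add: rel_frontier_def)
    qed
    obtain x where x: "x \<in> {0..1}" "c + d *\<^sub>R dir \<theta> = \<gamma> x"
      using d(2) \<gamma>(3) unfolding path_image_def by (metis imageE)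
    obtain i where i: "i \<le> n" "dist (\<gamma> (t i)) (\<gamma> x) < \<eta>" using near[OF x(1)] by blast
    have "(\<gamma> (t i) - c) \<bullet> dir \<theta> = (\<gamma> (t i) - \<gamma> x) \<bullet> dir \<theta> + d"
      by (simp add: x(2)[symmetric] inner_diff_left inner_add_left dir_unit)
    moreover have "\<bar>(\<gamma> (t i) - \<gamma> x) \<bullet> dir \<theta>\<bar> < \<eta>"
      using inner_dir_le[of "\<gamma> (t i) - \<gamma> x" \<theta>] i by (simp add: dist_norm)
    ultimately have "(\<gamma> (t i) - c) \<bullet> dir \<theta> > r - \<eta>" using \<open>r \<le> d\<close> by linarith
    then show ?thesis using i(1) by blast
  qed
  have "4 * (r - \<eta>) * (pi - 0) \<le> 2 * (\<Sum>i<n. dist (\<gamma> (t i)) (\<gamma> (t (Suc i))))"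
  proof (rule has_integral_le)
    show "((\<lambda>\<theta>. \<Sum>i<n. \<bar>\<gamma> (t (Suc i)) \<bullet> dir \<theta> - \<gamma> (t i) \<bullet> dir \<theta>\<bar>)
           has_integral 2 * (\<Sum>i<n. dist (\<gamma> (t i)) (\<gamma> (t (Suc i))))) {0..pi}"
      by (rule polygon_length_integral[OF Q(3)]) (use \<gamma>in fr tin in blast)
    show "((\<lambda>\<theta>. 4 * (r - \<eta>)) has_integral 4 * (r - \<eta>) * (pi - 0)) {0..pi}"
      using has_integral_const_real[of "4 * (r - \<eta>)" 0 pi] by (simp add: mult.commute)
  next
    fix \<theta> :: real
    obtain i where i: "i \<le> n" "(\<gamma> (t i) - c) \<bullet> dir \<theta> > r - \<eta>" using far by blast
    \<comment> \<open>the opposite extreme is the extreme in the opposite direction\<close>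
    obtain j where j: "j \<le> n" "(\<gamma> (t j) - c) \<bullet> dir (\<theta> + pi) > r - \<eta>" using far by blast
    have "dir (\<theta> + pi) = - dir \<theta>" by (simp add: dir_def)
    then have "2 * (r - \<eta>) \<le> \<gamma> (t i) \<bullet> dir \<theta> - \<gamma> (t j) \<bullet> dir \<theta>"
      using i(2) j(2) by (simp add: inner_diff_left)
    then have "4 * (r - \<eta>) \<le> 2 * \<bar>\<gamma> (t i) \<bullet> dir \<theta> - \<gamma> (t j) \<bullet> dir \<theta>\<bar>"
      using abs_ge_self[of "\<gamma> (t i) \<bullet> dir \<theta> - \<gamma> (t j) \<bullet> dir \<theta>"] by argo
    also have "\<dots> \<le> (\<Sum>i<n. \<bar>\<gamma> (t (Suc i)) \<bullet> dir \<theta> - \<gamma> (t i) \<bullet> dir \<theta>\<bar>)"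
    proof (rule sum_abs_diff_closed_ge[OF _ i(1) j(1)])
      have "t n = 1" "t 0 = 0" using n0 by (auto simp: t_def)
      then show "\<gamma> (t n) \<bullet> dir \<theta> = \<gamma> (t 0) \<bullet> dir \<theta>"
        using \<gamma>(2) by (simp add: pathfinish_def pathstart_def)
    qed
    finally show "4 * (r - \<eta>) \<le> (\<Sum>i<n. \<bar>\<gamma> (t (Suc i)) \<bullet> dir \<theta> - \<gamma> (t i) \<bullet> dir \<theta>\<bar>)" .
  qed
  moreover have "pi * \<eta> = e / 2" by (simp add: \<eta>_def)
  ultimately have "2 * pi * r - e \<le> (\<Sum>i<n. dist (\<gamma> (t i)) (\<gamma> (t (Suc i))))"
    by (simp add: algebra_simps)
  also have "\<dots> \<le> curve_length \<gamma>"
    unfolding curve_length_def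
  proof (rule cSup_upper)
    show "bdd_above {\<Sum>i<n. dist (\<gamma> (t i)) (\<gamma> (t (Suc i))) |n t. mono t \<and> range t \<subseteq> {0..1}}"
      by (rule bdd_aboveI[of _ "pi * diameter Q"]) (use polygon_length_le[OF Q \<gamma>(1,3)] in blast)
  qed (use t in blast)
  finally show "2 * pi * r \<le> curve_length \<gamma> + e" by simp
qed

end

text \<open>
  The boundary of a planar convex body is a homeomorphic image of the unit circle. The choice
  operator in the definition of the perimeter therefore picks an actual boundary curve.
\<close>

lemma ex_closed_path_rel_frontier:
  fixes Q :: "'a::euclidean_space set"
  assumes "convex Q" "bounded Q" "aff_dim Q = 2"
  shows "\<exists>\<gamma>. simple_path \<gamma> \<and> pathfinish \<gamma> = pathstart \<gamma> \<and> path_image \<gamma> = rel_frontier Q"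
proof -
  have "rel_frontier (cball (0::complex) 1) homeomorphic rel_frontier Q"
    by (rule homeomorphic_rel_frontiers_convex_bounded_sets) (use assms in \<open>auto simp: aff_dim_cball\<close>)
  then obtain g where g: "continuous_on (sphere 0 1) g" "g ` sphere (0::complex) 1 = rel_frontier Q"
      "inj_on g (sphere 0 1)"
    unfolding homeomorphic_def homeomorphism_def by (auto simp: inj_on_def) metis
  have im: "path_image (circlepath 0 1) = sphere 0 1" by simp
  have "simple_path (g \<circ> circlepath 0 1)"
    by (rule simple_path_continuous_image) (use g in \<open>auto simp: simple_path_circlepath\<close>)
  moreover have "path_image (g \<circ> circlepath 0 1) = rel_frontier Q"
    using g by (simp add: path_image_compose)
  moreover have "pathfinish (g \<circ> circlepath 0 1) = pathstart (g \<circ> circlepath 0 1)"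
    by (simp add: pathfinish_compose pathstart_compose)
  ultimately show ?thesis by blast
qed

section \<open>Projections and girth\<close>

lemma plane_orthonormal_frame:
  fixes H :: "'a::euclidean_space set"
  assumes "affine H" "aff_dim H = 2"
  obtains p e1 e2 where "orthonormal_pair e1 e2" "H = {p + a *\<^sub>R e1 + b *\<^sub>R e2 | a b. True}"
proof -
  obtain p where p: "p \<in> H" using assms by fastforce
  let ?S = "(\<lambda>x. x - p) ` H"
  have "subspace ?S" using affine_diffs_subspace_subtract[OF assms(1) p] .
  from orthonormal_basis_subspace[OF this]
  obtain B where B: "pairwise orthogonal B" "\<And>x. x \<in> B \<Longrightarrow> norm x = 1"
      "card B = dim ?S" "span B = ?S" by metis
  have "card B = 2" using aff_dim_dim_affine_diffs[OF assms(1) p] assms(2) B(3) by simp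
  then obtain e1 e2 where e: "B = {e1, e2}" "e1 \<noteq> e2" by (auto simp: card_2_iff)
  have "orthonormal_pair e1 e2"
    using B(1,2) e by unfold_locales (auto simp: pairwise_def orthogonal_def norm_eq_1)
  moreover have "H = {p + a *\<^sub>R e1 + b *\<^sub>R e2 | a b. True}"
  proof -
    have S: "?S = {a *\<^sub>R e1 + b *\<^sub>R e2 | a b. True}"
      unfolding B(4)[symmetric] e(1) by (auto simp: span_insert algebra_simps)
    show ?thesis
    proof safe
      fix x assume "x \<in> H"
      then have "x - p \<in> {a *\<^sub>R e1 + b *\<^sub>R e2 | a b. True}" unfolding S[symmetric] by blast
      then obtain a b where "x - p = a *\<^sub>R e1 + b *\<^sub>R e2" by blast
      then have "x = p + a *\<^sub>R e1 + b *\<^sub>R e2" by (simp add: algebra_simps)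
      then show "\<exists>a b. x = p + a *\<^sub>R e1 + b *\<^sub>R e2 \<and> True" by blast
    next
      fix a b
      have "a *\<^sub>R e1 + b *\<^sub>R e2 \<in> ?S" unfolding S by blast
      then show "p + a *\<^sub>R e1 + b *\<^sub>R e2 \<in> H" by (auto simp: algebra_simps)
    qed
  qed
  ultimately show ?thesis using that by blast
qed

lemma (in orthonormal_pair) closest_point_plane:
  assumes H: "H = {p + a *\<^sub>R e1 + b *\<^sub>R e2 | a b. True}" "affine H"
  shows "closest_point H x = p + ((x - p) \<bullet> e1) *\<^sub>R e1 + ((x - p) \<bullet> e2) *\<^sub>R e2"
proof -
  let ?y = "p + ((x - p) \<bullet> e1) *\<^sub>R e1 + ((x - p) \<bullet> e2) *\<^sub>R e2"
  have "?y = closest_point H x"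
  proof (rule closest_point_unique)
    show "convex H" "closed H" using H(2) by (auto intro: affine_imp_convex affine_closed)
    show "?y \<in> H" unfolding H(1) by blast
    show "\<forall>z\<in>H. dist x ?y \<le> dist x z"
    proof
      fix z assume "z \<in> H"
      then obtain a b where z: "z = p + a *\<^sub>R e1 + b *\<^sub>R e2" unfolding H(1) by blast
      let ?w = "((x - p) \<bullet> e1 - a) *\<^sub>R e1 + ((x - p) \<bullet> e2 - b) *\<^sub>R e2"
      have "x - z = (x - ?y) + ?w" by (simp add: z algebra_simps)
      moreover have "(x - ?y) \<bullet> e1 = 0" "(x - ?y) \<bullet> e2 = 0"
        by (simp_all add: inner_diff_left inner_add_left unit orth orth')
      then have "orthogonal (x - ?y) ?w"
        by (simp add: orthogonal_def inner_add_right)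
      ultimately have "(norm (x - z))\<^sup>2 = (norm (x - ?y))\<^sup>2 + (norm ?w)\<^sup>2"
        by (metis norm_add_Pythagorean)
      then have "(norm (x - ?y))\<^sup>2 \<le> (norm (x - z))\<^sup>2" by simp
      then show "dist x ?y \<le> dist x z" unfolding dist_norm by (rule power2_le_imp_le) simp
    qed
  qed
  then show ?thesis by simp
qed

text \<open>
  The projection onto \<open>H\<close> is, up to a translation, the linear map \<open>L\<close>, and it is nonexpansive. The shadow is
  therefore a planar convex body, it contains the disc below the ball, and its diameter does
  not exceed the diameter of \<open>K\<close>.
\<close>

lemma perimeter_projection_bounds:
  fixes K :: "'a::euclidean_space set"
  assumes K: "convex K" "compact K" "cball c r \<subseteq> K" "0 < r"
    and H: "affine H" "aff_dim H = 2"
  shows "2 * pi * r \<le> perimeter (closest_point H ` K)"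
    and "perimeter (closest_point H ` K) \<le> pi * diameter K"
proof -
  obtain p e1 e2 where fr: "orthonormal_pair e1 e2" and Heq: "H = {p + a *\<^sub>R e1 + b *\<^sub>R e2 | a b. True}"
    by (rule plane_orthonormal_frame[OF H])
  interpret orthonormal_pair e1 e2 by (rule fr)
  let ?Q = "closest_point H ` K"
  note cp = closest_point_plane[OF Heq H(1)]
  define L where "L x = (x \<bullet> e1) *\<^sub>R e1 + (x \<bullet> e2) *\<^sub>R e2" for x
  have "linear L" unfolding L_def
    by (intro linearI) (simp_all add: inner_add_left algebra_simps)
  note L_add = linear_add[OF \<open>linear L\<close>]
  have cpL: "closest_point H x = (p - L p) + L x" for x
    unfolding cp L_def by (simp add: inner_diff_left algebra_simps)
  have Qeq: "?Q = (\<lambda>x. (p - L p) + x) ` L ` K" by (auto simp: cpL image_image)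
  have "convex ?Q" unfolding Qeq
    by (intro convex_translation convex_linear_image \<open>linear L\<close> K)
  have Hne: "H \<noteq> {}" "closed H" "convex H" using H by (auto intro: affine_imp_convex affine_closed)
  have contcp: "continuous_on K (closest_point H)"
    using continuous_on_closest_point[OF Hne(3,2,1)] .
  then have "compact ?Q" by (intro compact_continuous_image K)
  have QH: "?Q \<subseteq> H" using closest_point_in_set[OF Hne(2,1)] by auto
  have "flat H" unfolding flat_def Heq
    by (auto simp: inner_diff_left inner_add_left unit orth orth' algebra_simps)
  then have "flat ?Q" using QH by (auto simp: flat_def)
  have LH: "L (u - w) = u - w" if "u \<in> H" "w \<in> H" for u w
    unfolding L_def by (rule bspec[OF bspec[OF \<open>flat H\<close>[unfolded flat_def] that(1)] that(2), symmetric])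
  let ?c = "closest_point H c"
  \<comment> \<open>a point of the plane near \<open>?c\<close> is the projection of its translate near \<open>c\<close>\<close>
  have disc: "ball ?c r \<inter> H \<subseteq> ?Q"
  proof
    fix y assume y: "y \<in> ball ?c r \<inter> H"
    have "closest_point H (c + d) = ?c + L d" for d
      unfolding cpL L_add by (simp add: add.assoc)
    moreover have "L (y - ?c) = y - ?c"
      using y closest_point_in_set[OF Hne(2,1), of c] by (intro LH) auto
    ultimately have "closest_point H (c + (y - ?c)) = y" by simp
    moreover have "c + (y - ?c) \<in> K" using y K(3) by (auto simp: dist_norm norm_minus_commute)
    ultimately show "y \<in> ?Q" by force
  qed
  have cH: "?c \<in> H" using closest_point_in_set[OF Hne(2,1)] .
  have "affine hull (H \<inter> ball ?c r) = affine hull H"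
    using cH K(4) by (intro affine_hull_affine_Int_open H) auto
  moreover have "affine hull (H \<inter> ball ?c r) \<subseteq> affine hull ?Q"
    using disc by (intro hull_mono) auto
  moreover have "affine hull ?Q \<subseteq> H" using QH H(1) by (intro hull_minimal)
  ultimately have affQ: "affine hull ?Q = H" using H(1) by (auto simp: hull_same)
  then have dimQ: "aff_dim ?Q = 2" using H(2) by (metis aff_dim_affine_hull)
  have crel: "?c \<in> rel_interior ?Q"
    unfolding mem_rel_interior_ball affQ using disc K(4) cH by (intro conjI exI[of _ r]) auto
  define \<gamma> where "\<gamma> = (SOME \<gamma>. simple_path \<gamma> \<and> pathfinish \<gamma> = pathstart \<gamma> \<and> path_image \<gamma> = rel_frontier ?Q)"
  have \<gamma>: "simple_path \<gamma>" "pathfinish \<gamma> = pathstart \<gamma>" "path_image \<gamma> = rel_frontier ?Q"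
    using someI_ex[OF ex_closed_path_rel_frontier[OF \<open>convex ?Q\<close> compact_imp_bounded[OF \<open>compact ?Q\<close>] dimQ]]
    unfolding \<gamma>_def by auto
  have per: "perimeter ?Q = curve_length \<gamma>" by (simp add: perimeter_def \<gamma>_def)
  have "diameter ?Q \<le> diameter K"
  proof (rule diameter_le)
    show "?Q \<noteq> {} \<or> 0 \<le> diameter K" using K by auto
    fix x y assume "x \<in> ?Q" "y \<in> ?Q"
    then obtain x' y' where "x' \<in> K" "y' \<in> K" "x = closest_point H x'" "y = closest_point H y'" by blast
    then show "norm (x - y) \<le> diameter K"
      using closest_point_lipschitz[OF Hne(3,2,1), of x' y']
        diameter_bounded_bound[OF compact_imp_bounded[OF K(2)], of x' y'] by (simp add: dist_norm)
  qed
  then show "perimeter ?Q \<le> pi * diameter K"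
    using curve_length_le[OF \<open>convex ?Q\<close> \<open>compact ?Q\<close> \<open>flat ?Q\<close> \<gamma>(1,3)] unfolding per
    by (meson mult_left_mono order_trans pi_ge_zero)
  have disc': "?c + a *\<^sub>R e1 + b *\<^sub>R e2 \<in> ?Q" if ab: "a\<^sup>2 + b\<^sup>2 \<le> r\<^sup>2" for a b
  proof -
    have "c + (a *\<^sub>R e1 + b *\<^sub>R e2) \<in> K"
    proof -
      have n: "(norm (a *\<^sub>R e1 + b *\<^sub>R e2))\<^sup>2 = a\<^sup>2 + b\<^sup>2"
        unfolding power2_norm_eq_inner
        by (simp add: inner_add_left inner_add_right unit orth orth' power2_eq_square)
      have "(norm (a *\<^sub>R e1 + b *\<^sub>R e2))\<^sup>2 \<le> r\<^sup>2" unfolding n by (rule ab)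
      then have "norm (a *\<^sub>R e1 + b *\<^sub>R e2) \<le> r" by (rule power2_le_imp_le) (use K(4) in simp)
      moreover have "dist c (c + w) = norm w" for w by (simp add: dist_norm)
      ultimately show ?thesis by (intro subsetD[OF K(3)]) (simp only: mem_cball)
    qed
    moreover have "closest_point H (c + (a *\<^sub>R e1 + b *\<^sub>R e2)) = ?c + a *\<^sub>R e1 + b *\<^sub>R e2"
    proof -
      have "L (a *\<^sub>R e1 + b *\<^sub>R e2) = a *\<^sub>R e1 + b *\<^sub>R e2"
        by (simp add: L_def inner_add_left unit orth orth')
      then show ?thesis unfolding cpL L_add by (simp add: add.assoc)
    qed
    ultimately show ?thesis by force
  qed
  show "2 * pi * r \<le> perimeter ?Q"
    unfolding per
    by (rule curve_length_ge[OF \<open>convex ?Q\<close> \<open>compact ?Q\<close> \<open>flat ?Q\<close> \<gamma> crel disc' K(4)])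
qed

lemma girth_bounds:
  assumes K: "convex K" "compact K" "cball c r \<subseteq> K" "0 < r"
  shows "2 * pi * r \<le> girth K" and "girth K \<le> pi * diameter K"
proof -
  let ?G = "{perimeter (closest_point H ` K) | H. affine H \<and> aff_dim H = 2}"
  obtain H0 :: "(real^3) set" where H0: "affine H0" "aff_dim H0 = 2"
    using choose_affine_subset[OF affine_UNIV, where d = 2 and 'a = "real^3"] by auto
  have ne: "perimeter (closest_point H0 ` K) \<in> ?G" using H0 by blast
  show "2 * pi * r \<le> girth K" unfolding girth_def
    using ne perimeter_projection_bounds(1)[OF K] by (intro cInf_greatest) auto
  have "bdd_below ?G"
    by (rule bdd_belowI[of _ "2 * pi * r"]) (use perimeter_projection_bounds(1)[OF K] in auto)
  then have "girth K \<le> perimeter (closest_point H0 ` K)"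
    unfolding girth_def by (intro cInf_lower ne)
  then show "girth K \<le> pi * diameter K"
    using perimeter_projection_bounds(2)[OF K H0] by linarith
qed

section \<open>Polyhedra that roll onto one face\<close>

text \<open>
  At a stable point \<open>q\<close> the plane orthogonal to \<open>q\<close> contains the face around \<open>q\<close>, so it is the
  plane of a constraint \<open>i\<close>, and \<open>q\<close> is the foot \<open>h i *\<^sub>R a i\<close>. For \<open>i \<noteq> i0\<close> the hypothesis
  \<open>roll\<close> says that this foot violates another constraint. Conversely the hypothesis forces \<open>h i0\<close> to
  be the strict minimum of the heights, so the foot of \<open>i0\<close> lies in \<open>P\<close> and satisfies all other
  constraints strictly. The hypotheses concern indices rather than normals, so a grid
  may list the same normal several times.
\<close>

lemma monostable_if_all_but_one_face_roll:
  fixes a :: "'i \<Rightarrow> real^3" and h :: "'i \<Rightarrow> real"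
  assumes I: "finite I" "i0 \<in> I"
    and unit: "\<And>i. i \<in> I \<Longrightarrow> norm (a i) = 1"
    and pos: "\<And>i. i \<in> I \<Longrightarrow> 0 < h i"
    and roll: "\<And>i. i \<in> I \<Longrightarrow> i \<noteq> i0 \<Longrightarrow> \<exists>j\<in>I. h j < h i * (a i \<bullet> a j)"
    and P: "P = {x. \<forall>i\<in>I. a i \<bullet> x \<le> h i}" "bounded P" "center_of_mass P = 0"
  shows "monostable P"
proof -
  have inner_le: "a i \<bullet> x \<le> norm x" if "i \<in> I" for i x
    using Cauchy_Schwarz_ineq2[of "a i" x] unit[OF that] by simp
  have self: "a i \<bullet> a i = 1" if "i \<in> I" for i using unit[OF that] by (simp add: norm_eq_1)
  have nz: "a i \<noteq> 0" if "i \<in> I" for i using unit[OF that] by auto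
  obtain m where m: "m \<in> I" "\<And>i. i \<in> I \<Longrightarrow> h m \<le> h i"
    using arg_min_if_finite[of I h] arg_min_least[of I _ h] I by (metis empty_iff)
  \<comment> \<open>rolling strictly decreases the height, so only \<open>i0\<close> can minimize it\<close>
  have min0: "i = i0" if i: "i \<in> I" "\<And>j. j \<in> I \<Longrightarrow> h i \<le> h j" for i
  proof (rule ccontr)
    assume "i \<noteq> i0"
    then obtain j where j: "j \<in> I" "h j < h i * (a i \<bullet> a j)" using roll i by blast
    have "h i * (a i \<bullet> a j) \<le> h i * 1"
      using inner_le[OF i(1), of "a j"] unit[OF j(1)] pos[OF i(1)] by (intro mult_left_mono) auto
    then show False using i(2)[OF j(1)] j(2) by simp
  qed
  have low: "h i0 < h i" if "i \<in> I" "i \<noteq> i0" for i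
  proof (rule ccontr)
    assume "\<not> h i0 < h i"
    then have "\<And>j. j \<in> I \<Longrightarrow> h i \<le> h j" using m min0[OF m] by force
    then show False using min0 that by blast
  qed
  then have low': "h i0 \<le> h i" if "i \<in> I" for i using that by (cases "i = i0") (auto simp: less_imp_le)
  have Peq: "P = \<Inter>((\<lambda>i. {x. a i \<bullet> x \<le> h i}) ` I)" unfolding P(1) by auto
  have "polyhedron P" unfolding Peq using I by (auto intro: polyhedron_halfspace_le)
  then have "polytope P" using P(2) by (simp add: polytope_eq_bounded_polyhedron)
  then obtain V where V: "finite V" "P = convex hull V" unfolding polytope_def by blast
  have cP: "compact P" "convex P" "closed P"
    using \<open>polytope P\<close> by (auto intro: polytope_imp_compact polytope_imp_convex compact_imp_closed)
  have ball: "ball 0 (h i0) \<subseteq> P"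
  proof
    fix x :: "real^3" assume "x \<in> ball 0 (h i0)"
    then have "norm x < h i0" by simp
    then show "x \<in> P" unfolding P(1) using inner_le low' by (smt (verit) mem_Collect_eq)
  qed
  then have "interior P \<noteq> {}" using pos[OF I(2)] by (metis all_not_in_conv centre_in_ball interior_maximal open_ball subsetD)
  then have poly: "convex_polyhedron P" unfolding convex_polyhedron_def convex_body_def using cP V by blast
  have face: "P \<inter> {x. a i \<bullet> x = h i} face_of P" if "i \<in> I" for i
    by (rule face_of_Int_supporting_hyperplane_le[OF cP(2)]) (use that in \<open>auto simp: P(1)\<close>)
  define q0 where "q0 = h i0 *\<^sub>R a i0"
  \<comment> \<open>the open region where only the constraint \<open>i0\<close> can be active\<close>
  define U where "U = (\<Inter>i\<in>I - {i0}. {x. a i \<bullet> x < h i})"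
  have "open U" unfolding U_def using I(1) by (intro open_INT) (auto simp: open_halfspace_lt)
  let ?G = "{x. a i0 \<bullet> x = h i0}"
  let ?F = "P \<inter> ?G"
  have q0G: "q0 \<in> ?G" using self[OF I(2)] by (simp add: q0_def)
  have q0U: "q0 \<in> U"
  proof -
    have "a i \<bullet> q0 < h i" if "i \<in> I" "i \<noteq> i0" for i
    proof -
      have "a i \<bullet> q0 = h i0 * (a i \<bullet> a i0)" by (simp add: q0_def)
      also have "\<dots> \<le> h i0 * 1"
        using inner_le[OF that(1), of "a i0"] unit[OF I(2)] pos[OF I(2)] by (intro mult_left_mono) auto
      finally show ?thesis using low[OF that] by simp
    qed
    then show ?thesis by (auto simp: U_def)
  qed
  have GU: "?G \<inter> U \<subseteq> ?F"
    by (auto simp: U_def P(1)) (metis DiffI empty_iff insert_iff less_imp_le order_refl)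
  have q0P: "q0 \<in> P" using q0G q0U GU by blast
  have "affine hull (?G \<inter> U) = affine hull ?G"
    using q0G q0U \<open>open U\<close> by (intro affine_hull_affine_Int_open affine_hyperplane) auto
  moreover have "affine hull (?G \<inter> U) \<subseteq> affine hull ?F" using GU by (rule hull_mono)
  moreover have "affine hull ?F \<subseteq> affine hull ?G" by (rule hull_mono) auto
  ultimately have affF: "affine hull ?F = ?G"
    using affine_hyperplane[of "a i0" "h i0"] by (simp add: hull_same)
  have dimG: "aff_dim {x. a i \<bullet> x = b} = 2" if "i \<in> I" for i b
    using nz[OF that] by (simp add: aff_dim_hyperplane)
  have stable0: "stable_point P q0"
    unfolding stable_point_def equilibrium_point_def
  proof (intro conjI exI[of _ ?F])
    have "q0 \<notin> interior P"
    proof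
      assume "q0 \<in> interior P"
      moreover have "interior P \<subseteq> interior {x. a i0 \<bullet> x \<le> h i0}"
        using I by (intro interior_mono) (auto simp: P(1))
      ultimately show False using q0G nz[OF I(2)] by (auto simp: interior_halfspace_le)
    qed
    then show "q0 \<in> frontier P" using q0P closure_subset by (auto simp: frontier_def)
    have "q0 \<noteq> 0" using pos[OF I(2)] nz[OF I(2)] by (simp add: q0_def)
    moreover have "q0 \<bullet> x \<le> q0 \<bullet> q0" if "x \<in> P" for x
      using that I(2) pos[OF I(2)] self[OF I(2)] by (auto simp: q0_def P(1) intro!: mult_left_mono)
    ultimately show "supports (q0 - center_of_mass P) ((q0 - center_of_mass P) \<bullet> q0) P"
      unfolding supports_def P(3) using q0P by auto
    show "?F face_of P" by (rule face[OF I(2)])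
    show "aff_dim ?F = 2" using affF dimG[OF I(2)] by (metis aff_dim_affine_hull)
    show "q0 \<in> rel_interior ?F"
      unfolding mem_rel_interior affF using \<open>open U\<close> q0U q0G q0P GU by blast
  qed
  have only: "q = q0" if q: "stable_point P q" for q
  proof -
    obtain F where F: "F face_of P" "aff_dim F = 2" "q \<in> rel_interior F"
      using q by (auto simp: stable_point_def)
    have qfr: "q \<in> frontier P" and sup: "supports q (q \<bullet> q) P"
      using q P(3) by (auto simp: stable_point_def equilibrium_point_def)
    have qP: "q \<in> P" using qfr cP(3) by (simp add: frontier_def closure_closed)
    have FP: "F \<subseteq> P" using F(1) by (rule face_of_imp_subset)
    have "\<exists>i\<in>I. a i \<bullet> q = h i"
    proof (rule ccontr)
      assume no: "\<not> ?thesis"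
      let ?W = "\<Inter>i\<in>I. {x. a i \<bullet> x < h i}"
      have "open ?W" using I(1) by (intro open_INT) (auto simp: open_halfspace_lt)
      moreover have "?W \<subseteq> P" by (auto simp: P(1) less_imp_le)
      moreover have "q \<in> ?W" using no qP by (auto simp: P(1) less_le)
      ultimately have "q \<in> interior P" by (meson interiorI)
      then show False using qfr by (simp add: frontier_def)
    qed
    then obtain i where i: "i \<in> I" "a i \<bullet> q = h i" by blast
    have "F \<subseteq> P \<inter> {x. a i \<bullet> x = h i}"
      by (rule subset_of_face_of[OF face[OF i(1)] FP]) (use F(3) qP i in blast)
    then have F1: "F \<subseteq> {x. a i \<bullet> x = h i}" by blast
    have "P \<inter> {x. q \<bullet> x = q \<bullet> q} face_of P"
      using sup face_of_Int_supporting_hyperplane_le[OF cP(2), where a = q and b = "q \<bullet> q"]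
        face_of_Int_supporting_hyperplane_ge[OF cP(2), where a = q and b = "q \<bullet> q"]
      unfolding supports_def by blast
    then have "F \<subseteq> P \<inter> {x. q \<bullet> x = q \<bullet> q}"
      by (rule subset_of_face_of[OF _ FP]) (use F(3) qP in blast)
    then have F2: "affine hull F \<subseteq> {x. q \<bullet> x = q \<bullet> q}"
      by (intro hull_minimal affine_hyperplane) blast
    have "affine hull F = {x. a i \<bullet> x = h i}"
    proof (rule affine_dim_equal)
      show "affine hull F \<subseteq> {x. a i \<bullet> x = h i}"
        using F1 by (intro hull_minimal affine_hyperplane)
      show "affine hull F \<noteq> {}" using F(2) by auto
      show "aff_dim (affine hull F) = aff_dim {x. a i \<bullet> x = h i}"
        using F(2) dimG[OF i(1)] by simp
    qed (auto simp: affine_hyperplane)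
    moreover have "a i \<bullet> (h i *\<^sub>R a i) = h i" using self[OF i(1)] by simp
    ultimately have "q \<bullet> (h i *\<^sub>R a i) = q \<bullet> q" using F2 by blast
    then have "(q - h i *\<^sub>R a i) \<bullet> (q - h i *\<^sub>R a i) = 0"
      using i self[OF i(1)] by (simp add: inner_diff_left inner_diff_right inner_commute)
    then have qi: "q = h i *\<^sub>R a i" by simp
    have "i = i0"
    proof (rule ccontr)
      assume "i \<noteq> i0"
      then obtain j where "j \<in> I" "h j < h i * (a i \<bullet> a j)" using roll i by blast
      then show False using qP qi by (auto simp: P(1) inner_commute)
    qed
    then show ?thesis using qi by (simp add: q0_def)
  qed
  show ?thesis unfolding monostable_def using poly stable0 only by blast
qed

section \<open>Moments of bodies\<close>

definition sign_flip :: "('a \<Rightarrow> real) \<Rightarrow> 'a \<Rightarrow> 'a::euclidean_space" where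
  "sign_flip c x = (\<Sum>j\<in>Basis. (c j * (x \<bullet> j)) *\<^sub>R j)"

lemma inner_sign_flip: "b \<in> Basis \<Longrightarrow> sign_flip c x \<bullet> b = c b * (x \<bullet> b)"
  by (simp add: sign_flip_def inner_sum_left inner_Basis if_distrib cong: if_cong)

lemma lborel_distr_sign_flip:
  fixes c :: "'a::euclidean_space \<Rightarrow> real"
  assumes "\<And>j. j \<in> Basis \<Longrightarrow> \<bar>c j\<bar> = 1"
  shows "distr lborel borel (sign_flip c) = lborel"
proof -
  have "c j \<noteq> 0" if "j \<in> Basis" for j using assms[OF that] by auto
  from lborel_affine_euclidean[where c = c and t = 0, OF this]
  have "lborel = density (distr lborel borel (sign_flip c)) (\<lambda>_. ennreal (\<Prod>j\<in>Basis. \<bar>c j\<bar>))"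
    by (simp add: sign_flip_def[abs_def])
  also have "(\<Prod>j\<in>Basis. \<bar>c j\<bar>) = 1" using assms by simp
  finally show ?thesis by (simp add: density_1)
qed

text \<open>
  Sign changes of coordinates preserve Lebesgue measure, so the moment equals its own negative.
\<close>

lemma moment_eq_0_if_symmetric:
  fixes S :: "'a::euclidean_space set"
  assumes c: "\<And>j. j \<in> Basis \<Longrightarrow> \<bar>c j\<bar> = 1"
    and S: "S \<in> sets borel" "\<And>x. x \<in> S \<Longrightarrow> sign_flip c x \<in> S"
    and b: "b \<in> Basis" "c b = -1"
  shows "(LINT x:S|lborel. x \<bullet> b) = 0"
proof -
  have "sign_flip c (sign_flip c x) = x" for x
  proof (rule euclidean_eqI)
    fix j :: 'a assume j: "j \<in> Basis"
    then have "c j * c j = 1" using c[OF j] by (metis abs_mult_self_eq mult.right_neutral)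
    then show "sign_flip c (sign_flip c x) \<bullet> j = x \<bullet> j" using j by (simp add: inner_sign_flip flip: mult.assoc)
  qed
  then have inv: "sign_flip c x \<in> S \<longleftrightarrow> x \<in> S" for x using S(2) by metis
  have [measurable]: "sign_flip c \<in> borel_measurable borel"
    unfolding sign_flip_def by measurable
  note S(1)[measurable]
  have "(LINT x:S|lborel. x \<bullet> b) = (LINT x:S|distr lborel borel (sign_flip c). x \<bullet> b)"
    using lborel_distr_sign_flip[of c, OF c] by simp
  also have "\<dots> = (\<integral>x. indicator S (sign_flip c x) *\<^sub>R (sign_flip c x \<bullet> b) \<partial>lborel)"
    unfolding set_lebesgue_integral_def by (subst integral_distr) auto
  also have "\<dots> = (\<integral>x. - (indicator S x *\<^sub>R (x \<bullet> b)) \<partial>lborel)"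
    by (intro Bochner_Integration.integral_cong refl) (simp add: inner_sign_flip b indicator_def inv)
  also have "\<dots> = - (LINT x:S|lborel. x \<bullet> b)" unfolding set_lebesgue_integral_def by simp
  finally show ?thesis by simp
qed

lemma inner_vector_moment:
  fixes S :: "'a::euclidean_space set"
  assumes "compact S"
  shows "(LINT x:S|lborel. x) \<bullet> e = (LINT x:S|lborel. x \<bullet> e)"
proof -
  have int: "integrable lborel (\<lambda>x. indicator S x *\<^sub>R x)"
    using assms by (intro borel_integrable_compact) auto
  have "(\<integral>x. indicator S x *\<^sub>R x \<partial>lborel) \<bullet> e = (\<integral>x. (indicator S x *\<^sub>R x) \<bullet> e \<partial>lborel)"
    by (rule integral_inner_left[symmetric]) (rule int)
  then show ?thesis by (simp add: set_lebesgue_integral_def)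
qed

lemma vector_moment_eq_0_iff:
  fixes S :: "'a::euclidean_space set"
  assumes "compact S"
  shows "(LINT x:S|lborel. x) = 0 \<longleftrightarrow> (\<forall>b\<in>Basis. (LINT x:S|lborel. x \<bullet> b) = 0)"
  using inner_vector_moment[OF assms] by (metis euclidean_all_zero_iff)

lemma center_of_mass_eq_0_if_moments:
  fixes S :: "'a::euclidean_space set"
  assumes "compact S" "\<And>b. b \<in> Basis \<Longrightarrow> (LINT x:S|lborel. x \<bullet> b) = 0"
  shows "center_of_mass S = 0"
  using assms vector_moment_eq_0_iff[OF assms(1)] by (simp add: center_of_mass_def)

lemma AE_not_on_hyperplane:
  fixes a :: "'a::euclidean_space"
  assumes "a \<noteq> 0"
  shows "AE x in lborel. a \<bullet> x \<noteq> b"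
proof -
  have "{x. a \<bullet> x = b} \<in> null_sets lebesgue"
    using negligible_hyperplane[of a b] assms by (simp add: negligible_iff_null_sets)
  from AE_not_in[OF this] show ?thesis by (simp add: AE_completion_iff)
qed

text \<open>
  A point that lies on none of the planes bounding \<open>P t\<close> is inside or outside \<open>P s\<close> for all \<open>s\<close>
  near \<open>t\<close> alike. The exceptional points form a null set, and dominated convergence applies.
\<close>

lemma continuous_on_moment_polyhedron:
  fixes a :: "'i \<Rightarrow> 'a::euclidean_space" and h :: "real \<Rightarrow> 'i \<Rightarrow> real"
  assumes I: "finite I" "\<And>i. i \<in> I \<Longrightarrow> a i \<noteq> 0"
    and h: "\<And>i. i \<in> I \<Longrightarrow> continuous_on T (\<lambda>t. h t i)"
    and P: "\<And>t. P t = {x. \<forall>i\<in>I. a i \<bullet> x \<le> h t i}"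
    and B: "\<And>t. t \<in> T \<Longrightarrow> P t \<subseteq> cball 0 B"
  shows "continuous_on T (\<lambda>t. LINT x:P t|lborel. x \<bullet> b)"
  unfolding continuous_on_sequentially
proof safe
  fix s :: "nat \<Rightarrow> _" and t
  assume t: "t \<in> T" "\<forall>n. s n \<in> T" "s \<longlonglongrightarrow> t"
  have P': "P t = (\<Inter>i\<in>I. {x. a i \<bullet> x \<le> h t i})" for t by (auto simp: P)
  have [measurable]: "P t \<in> sets borel" for t
    unfolding P' by (intro borel_closed closed_INT) (auto simp: closed_halfspace_le)
  have "(\<lambda>n. \<integral>x. indicator (P (s n)) x *\<^sub>R (x \<bullet> b) \<partial>lborel) \<longlonglongrightarrow> (\<integral>x. indicator (P t) x *\<^sub>R (x \<bullet> b) \<partial>lborel)"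
  proof (rule integral_dominated_convergence[where w = "\<lambda>x. indicator (cball 0 B) x *\<^sub>R (norm x * norm b)"])
    show "integrable lborel (\<lambda>x::'a. indicator (cball 0 B) x *\<^sub>R (norm x * norm b))"
      by (intro borel_integrable_compact continuous_intros) auto
    have "AE x in lborel. \<forall>i\<in>I. a i \<bullet> x \<noteq> h t i"
      using I by (intro AE_finite_allI AE_not_on_hyperplane)
    then show "AE x in lborel. (\<lambda>n. indicator (P (s n)) x *\<^sub>R (x \<bullet> b)) \<longlonglongrightarrow> indicator (P t) x *\<^sub>R (x \<bullet> b)"
    proof eventually_elim
      case (elim x)
      have lim: "(\<lambda>n. h (s n) i) \<longlonglongrightarrow> h t i" if "i \<in> I" for i
        using h[OF that] t unfolding continuous_on_sequentially by (auto simp: o_def)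
      have "\<forall>\<^sub>F n in sequentially. (a i \<bullet> x \<le> h (s n) i \<longleftrightarrow> a i \<bullet> x \<le> h t i)" if "i \<in> I" for i
      proof (cases "a i \<bullet> x < h t i")
        case True
        from order_tendstoD(1)[OF lim[OF that] this] show ?thesis
          by eventually_elim (use True in auto)
      next
        case False
        then have "h t i < a i \<bullet> x" using elim that by force
        from order_tendstoD(2)[OF lim[OF that] this] show ?thesis
          by eventually_elim (use False elim that in force)
      qed
      then have "\<forall>\<^sub>F n in sequentially. \<forall>i\<in>I. (a i \<bullet> x \<le> h (s n) i \<longleftrightarrow> a i \<bullet> x \<le> h t i)"
        using I(1) by (simp add: eventually_ball_finite_distrib)
      then have "\<forall>\<^sub>F n in sequentially. indicator (P (s n)) x *\<^sub>R (x \<bullet> b) = indicator (P t) x *\<^sub>R (x \<bullet> b)"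
        by eventually_elim (auto simp: P indicator_def)
      then show ?case by (rule tendsto_eventually)
    qed
    fix n
    have "P (s n) \<subseteq> cball 0 B" using B t(2) by blast
    then show "AE x in lborel. norm (indicator (P (s n)) x *\<^sub>R (x \<bullet> b)) \<le> indicator (cball 0 B) x *\<^sub>R (norm x * norm b)"
      by (intro AE_I2) (auto simp: indicator_def Cauchy_Schwarz_ineq2)
  qed measurable
  then show "((\<lambda>t. LINT x:P t|lborel. x \<bullet> b) \<circ> s) \<longlonglongrightarrow> (LINT x:P t|lborel. x \<bullet> b)"
    by (simp add: set_lebesgue_integral_def o_def)
qed

text \<open>
  The unit ball contributes nothing. The ball around \<open>p\<close>, which lies outside the unit ball, contributes at
  least half its volume, whereas on the side \<open>x \<bullet> e < 0\<close> the body exceeds the unit ball only within the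
  thin shell up to radius \<open>R\<close>. The last hypothesis compares the volume of the shell with that of
  the ball around \<open>p\<close>.
\<close>

lemma moment_pos_if_bump:
  fixes P :: "'a::euclidean_space set"
  assumes P: "compact P" "cball 0 1 \<subseteq> P"
    and bump: "cball p r \<subseteq> P" "cball p r \<inter> cball 0 1 = {}" "\<And>x. x \<in> cball p r \<Longrightarrow> 1 / 2 \<le> x \<bullet> e" "0 < r"
    and e: "norm e = 1"
    and R: "\<And>x. x \<in> P \<Longrightarrow> x \<bullet> e < 0 \<Longrightarrow> norm x \<le> R" "1 \<le> R" "R \<le> 2"
    and small: "4 * (R ^ DIM('a) - 1) < r ^ DIM('a)"
  shows "0 < (LINT x:P|lborel. x \<bullet> e)"
proof -
  let ?d = "DIM('a)" and ?V = "unit_ball_vol (real DIM('a))"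
  have int: "integrable lborel (\<lambda>x. indicator S x *\<^sub>R (x \<bullet> e))" if "compact S" for S :: "'a set"
    by (rule borel_integrable_compact[OF that]) (intro continuous_intros)
  have intc: "integrable lborel (indicat_real (cball q \<rho>))" for q :: 'a and \<rho>
    by (intro integrable_real_indicator emeasure_lborel_cball_finite) auto
  have meas: "(\<integral>x. indicat_real (cball q \<rho>) x \<partial>lborel) = ?V * \<rho> ^ ?d" if "0 \<le> \<rho>" for q :: 'a and \<rho>
    using content_cball[OF that, of q] by simp
  have ball0: "(\<integral>x. indicator (cball 0 1) x *\<^sub>R (x \<bullet> e) \<partial>lborel) = 0"
  proof -
    have flip: "sign_flip (\<lambda>_. -1) x = - x" for x :: 'a
      by (rule euclidean_eqI) (simp add: inner_sign_flip)
    have "(LINT x:cball 0 1|lborel. x \<bullet> b) = 0" if "b \<in> Basis" for b :: 'a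
      by (rule moment_eq_0_if_symmetric[where c = "\<lambda>_. -1"]) (use that in \<open>auto simp: flip\<close>)
    then have "(LINT x:cball (0::'a) 1|lborel. x) = 0" by (simp add: vector_moment_eq_0_iff)
    then show ?thesis
      using inner_vector_moment[OF compact_cball, of "0::'a" 1 e] by (simp add: set_lebesgue_integral_def)
  qed
  define f where "f x = indicator (cball 0 1) x *\<^sub>R (x \<bullet> e)" for x :: 'a
  define k where "k q \<rho> = indicat_real (cball q \<rho>)" for q :: 'a and \<rho>
  have f: "integrable lborel f" "integral\<^sup>L lborel f = 0"
    using int[of "cball 0 1"] ball0 by (simp_all add: f_def[abs_def])
  have k: "integrable lborel (k q \<rho>)" "0 \<le> \<rho> \<Longrightarrow> integral\<^sup>L lborel (k q \<rho>) = ?V * \<rho> ^ ?d" for q \<rho>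
    using intc[of q \<rho>] meas[of \<rho> q] by (simp_all add: k_def)
  \<comment> \<open>\<open>?g\<close> is a pointwise lower bound for the integrand of the moment: unit ball, bump, shell\<close>
  let ?g = "\<lambda>x. f x + 1 / 2 * k p r x - 2 * (k 0 R x - k 0 1 x)"
  have le: "?g x \<le> indicator P x *\<^sub>R (x \<bullet> e)" for x
  proof -
    have ip: "\<bar>x \<bullet> e\<bar> \<le> norm x" using Cauchy_Schwarz_ineq2[of x e] e by simp
    have R1: "norm x \<le> 1 \<Longrightarrow> norm x \<le> R" using R(2) by simp
    consider "x \<in> cball 0 1" | "x \<in> cball p r" "x \<notin> cball 0 1" | "x \<in> P" "x \<notin> cball p r" "x \<notin> cball 0 1" | "x \<notin> P"
      by blast
    then show ?thesis
    proof cases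
      case 1
      then have "x \<in> P" "x \<notin> cball p r" using P(2) bump(2) by auto
      then show ?thesis using 1 R1 by (simp add: f_def k_def indicator_def)
    next
      case 2
      then have "x \<in> P" using bump(1) by auto
      then show ?thesis using 2 bump(3)[OF 2(1)] by (simp add: f_def k_def indicator_def)
    next
      case 3
      show ?thesis
      proof (cases "x \<bullet> e < 0")
        case True
        then have "norm x \<le> R" using R(1) 3 by blast
        moreover have "- 2 \<le> x \<bullet> e" using ip \<open>norm x \<le> R\<close> R(3) by linarith
        ultimately show ?thesis using 3 by (simp add: f_def k_def indicator_def)
      next
        case False
        then show ?thesis using 3 by (simp add: f_def k_def indicator_def)
      qed
    next
      case 4
      then have "x \<notin> cball 0 1" "x \<notin> cball p r" using P(2) bump(1) by auto
      then show ?thesis using 4 by (simp add: f_def k_def indicator_def)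
    qed
  qed
  have "0 < ?V / 2 * (r ^ ?d - 4 * (R ^ ?d - 1))" using small by (intro mult_pos_pos) auto
  also have "\<dots> = 1 / 2 * (?V * r ^ ?d) - 2 * (?V * R ^ ?d - ?V * 1 ^ ?d)" by (simp add: algebra_simps)
  also have "\<dots> = (\<integral>x. ?g x \<partial>lborel)" using bump(4) R(2) by (simp add: f k)
  also have "\<dots> \<le> (\<integral>x. indicator P x *\<^sub>R (x \<bullet> e) \<partial>lborel)"
    using le P(1) by (intro integral_mono Bochner_Integration.integrable_add Bochner_Integration.integrable_diff
        integrable_mult_right int f k)
  finally show ?thesis by (simp add: set_lebesgue_integral_def)
qed

section \<open>Monostable polyhedra close to a ball\<close>

lemma one_minus_half_square_le_cos: "1 - x\<^sup>2 / 2 \<le> cos (x::real)"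
proof -
  have "\<bar>sin (x / 2)\<bar> \<le> \<bar>x / 2\<bar>" by (rule abs_sin_x_le_abs_x)
  then have "(sin (x / 2))\<^sup>2 \<le> (x / 2)\<^sup>2" unfolding abs_le_square_iff .
  moreover have "cos x = 1 - 2 * (sin (x / 2))\<^sup>2" using cos_double_sin[of "x / 2"] by simp
  ultimately show ?thesis by (simp add: power_divide)
qed

lemma cos_diff_le: "cos a - cos b \<le> \<bar>a - b\<bar>" for a b :: real
proof -
  have "cos a - cos b = 2 * (sin ((a + b) / 2) * sin ((b - a) / 2))"
    using cos_diff_cos[of a b] by (simp add: mult.assoc)
  also have "\<dots> \<le> 2 * (\<bar>sin ((a + b) / 2)\<bar> * \<bar>sin ((b - a) / 2)\<bar>)"
    by (simp flip: abs_mult)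
  also have "\<dots> \<le> 2 * (1 * \<bar>(b - a) / 2\<bar>)"
    by (intro mult_left_mono mult_mono abs_sin_x_le_abs_x) auto
  finally show ?thesis by (simp add: abs_minus_commute)
qed

text \<open>
  Spherical coordinates around the second axis: \<open>\<theta>\<close> is the position on the great circle \<open>G\<close> in the
  plane of the first and third axes, measured from the bottom \<open>vector [0, 0, -1]\<close>, and \<open>\<alpha>\<close> is the
  elevation above this plane. The curves of constant \<open>\<theta>\<close> are the arcs orthogonal to \<open>G\<close>.
\<close>

definition sph :: "real \<Rightarrow> real \<Rightarrow> real^3" where
  "sph \<theta> \<alpha> = vector [cos \<alpha> * sin \<theta>, sin \<alpha>, - cos \<alpha> * cos \<theta>]"

lemma inner_sph_vector:
  "sph \<theta> \<alpha> \<bullet> x = cos \<alpha> * sin \<theta> * x $ 1 + sin \<alpha> * x $ 2 - cos \<alpha> * cos \<theta> * x $ 3"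
  by (simp add: sph_def inner_vec_def sum_3)

lemma inner_sph: "sph \<theta> \<alpha> \<bullet> sph \<theta>' \<alpha>' = cos \<alpha> * cos \<alpha>' * cos (\<theta> - \<theta>') + sin \<alpha> * sin \<alpha>'"
  by (simp add: inner_sph_vector) (simp add: sph_def cos_diff algebra_simps)

lemma norm_sph [simp]: "norm (sph \<theta> \<alpha>) = 1"
proof -
  have "sph \<theta> \<alpha> \<bullet> sph \<theta> \<alpha> = 1" by (simp add: inner_sph flip: power2_eq_square)
  then show ?thesis by (simp add: norm_eq_1)
qed

lemma inner_sph_le: "sph \<theta> \<alpha> \<bullet> x \<le> norm x"
  using Cauchy_Schwarz_ineq2[of "sph \<theta> \<alpha>" x] by simp

lemma ex_sph:
  fixes x :: "real^3"
  obtains \<theta> \<alpha> where "\<bar>\<theta>\<bar> \<le> pi" "\<bar>\<alpha>\<bar> \<le> pi / 2" "x = norm x *\<^sub>R sph \<theta> \<alpha>"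
proof (cases "x = 0")
  case True
  then show ?thesis using that[of 0 0] by simp
next
  case False
  define y where "y = x /\<^sub>R norm x"
  have "norm y = 1" using False by (simp add: y_def)
  then have y: "(y$1)\<^sup>2 + (y$2)\<^sup>2 + (y$3)\<^sup>2 = 1"
    by (simp add: norm_eq_1 inner_vec_def sum_3 power2_eq_square)
  define \<alpha> where "\<alpha> = arcsin (y$2)"
  have "(y$2)\<^sup>2 \<le> 1" using y zero_le_power2[of "y$1"] zero_le_power2[of "y$3"] by linarith
  then have y2: "\<bar>y$2\<bar> \<le> 1" by (simp add: abs_square_le_1)
  have \<alpha>: "\<bar>\<alpha>\<bar> \<le> pi / 2" "sin \<alpha> = y$2"
    using y2 arcsin_bounded[of "y$2"] by (auto simp: \<alpha>_def abs_le_iff)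
  have c0: "0 \<le> cos \<alpha>" using \<alpha>(1) by (intro cos_ge_zero) auto
  have c: "(cos \<alpha>)\<^sup>2 = (y$1)\<^sup>2 + (y$3)\<^sup>2" using y \<alpha>(2) by (simp add: cos_squared_eq)
  have "\<exists>\<theta>. \<bar>\<theta>\<bar> \<le> pi \<and> y$1 = cos \<alpha> * sin \<theta> \<and> y$3 = - cos \<alpha> * cos \<theta>"
  proof (cases "cos \<alpha> = 0")
    case True
    then show ?thesis using c by (intro exI[of _ 0]) (simp add: sum_power2_eq_zero_iff)
  next
    case False
    then have c1: "0 < cos \<alpha>" using c0 by simp
    have "(- y$3 / cos \<alpha>)\<^sup>2 + (\<bar>y$1\<bar> / cos \<alpha>)\<^sup>2 = ((y$1)\<^sup>2 + (y$3)\<^sup>2) / (cos \<alpha>)\<^sup>2"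
      by (simp add: power_divide add_divide_distrib)
    also have "\<dots> = 1" unfolding c[symmetric] using c1 by simp
    finally have "(- y$3 / cos \<alpha>)\<^sup>2 + (\<bar>y$1\<bar> / cos \<alpha>)\<^sup>2 = 1" .
    then obtain t where t: "0 \<le> t" "t \<le> pi" "- y$3 / cos \<alpha> = cos t" "\<bar>y$1\<bar> / cos \<alpha> = sin t"
      using sincos_total_pi[of "\<bar>y$1\<bar> / cos \<alpha>" "- y$3 / cos \<alpha>"] c0 by auto
    define \<theta> where "\<theta> = (if 0 \<le> y$1 then t else - t)"
    have "y$1 = cos \<alpha> * sin \<theta>" using t(4) c1 by (auto simp: \<theta>_def field_simps abs_if split: if_splits)
    moreover have "y$3 = - cos \<alpha> * cos \<theta>" using t(3) c1 by (auto simp: \<theta>_def field_simps)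
    ultimately show ?thesis using t by (intro exI[of _ \<theta>]) (auto simp: \<theta>_def)
  qed
  then obtain \<theta> where \<theta>: "\<bar>\<theta>\<bar> \<le> pi" "y$1 = cos \<alpha> * sin \<theta>" "y$3 = - cos \<alpha> * cos \<theta>" by blast
  have "y = sph \<theta> \<alpha>" by (simp add: vec_eq_iff forall_3 sph_def \<theta> \<alpha>)
  then have "x = norm x *\<^sub>R sph \<theta> \<alpha>" using False by (simp add: y_def flip: \<open>y = sph \<theta> \<alpha>\<close>)
  then show ?thesis using that \<theta>(1) \<alpha>(1) by blast
qed

lemma ex_grid_angle:
  fixes N :: nat
  assumes "0 < N" "0 < w" "\<bar>\<theta>\<bar> \<le> w"
  obtains j :: int where "\<bar>j\<bar> \<le> int N" "\<bar>\<theta> - real_of_int j * w / N\<bar> \<le> w / N"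
proof -
  define j where "j = \<lfloor>\<theta> * N / w\<rfloor>"
  have "\<bar>\<theta> * N / w\<bar> \<le> N" using assms by (simp add: abs_mult field_simps)
  then have b: "- real N \<le> \<theta> * N / w" "\<theta> * N / w \<le> real N" by linarith+
  have "- int N \<le> j" "j \<le> int N"
    unfolding j_def using b floor_mono[OF b(2)] by (simp_all add: le_floor_iff)
  then have jN: "\<bar>j\<bar> \<le> int N" by simp
  have "\<bar>\<theta> * N / w - j\<bar> \<le> 1" unfolding j_def by linarith
  then have "\<bar>\<theta> * N / w - j\<bar> * (w / N) \<le> 1 * (w / N)" using assms by (intro mult_right_mono) auto
  then have "\<bar>(\<theta> * N / w - j) * (w / N)\<bar> \<le> w / N" using assms by (simp add: abs_mult)
  moreover have eq: "(\<theta> * N / w - j) * (w / N) = \<theta> - j * w / N" using assms by (simp add: field_simps)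
  ultimately have "\<bar>\<theta> - j * w / N\<bar> \<le> w / N" by (simp only: eq)
  with jN show ?thesis by (rule that)
qed

text \<open>
  The constant \<open>10\<close> is \<open>2 + 8\<close>: with \<open>pi < 4\<close>, the two angle differences cost at most
  \<open>(pi / 2 / N)\<^sup>2 / 2 \<le> 2 / N\<^sup>2\<close> and \<open>(pi / N)\<^sup>2 / 2 \<le> 8 / N\<^sup>2\<close>.
\<close>

lemma inner_sph_near:
  assumes "\<bar>\<theta> - \<theta>'\<bar> \<le> pi / N" "\<bar>\<alpha> - \<alpha>'\<bar> \<le> pi / 2 / N" "0 \<le> cos \<alpha>" "0 \<le> cos \<alpha>'" "0 < (N::real)"
  shows "1 - 10 / N\<^sup>2 \<le> sph \<theta> \<alpha> \<bullet> sph \<theta>' \<alpha>'"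
proof -
  define y where "y = 1 / N\<^sup>2"
  have pi16: "pi\<^sup>2 \<le> 16" using pi_less_4 power_mono[of pi 4 2] by simp
  have "(\<theta> - \<theta>')\<^sup>2 \<le> (pi / N)\<^sup>2" "(\<alpha> - \<alpha>')\<^sup>2 \<le> (pi / 2 / N)\<^sup>2"
    using assms by (simp_all add: abs_le_square_iff[symmetric])
  then have sq: "(\<theta> - \<theta>')\<^sup>2 \<le> 16 * y" "(\<alpha> - \<alpha>')\<^sup>2 \<le> 4 * y"
    using pi16 divide_right_mono[OF pi16, of "N\<^sup>2"] by (auto simp: power_divide y_def)
  define z where "z = cos \<alpha> * cos \<alpha>' * (1 - cos (\<theta> - \<theta>'))"
  have "z \<le> 1 * (1 - cos (\<theta> - \<theta>'))"
    unfolding z_def using assms by (intro mult_right_mono mult_le_one) auto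
  then have "z \<le> 1 - cos (\<theta> - \<theta>')" by simp
  moreover have "sph \<theta> \<alpha> \<bullet> sph \<theta>' \<alpha>' = cos (\<alpha> - \<alpha>') - z"
    unfolding z_def by (simp add: inner_sph cos_diff[of \<alpha>] algebra_simps)
  moreover note one_minus_half_square_le_cos[of "\<theta> - \<theta>'"] one_minus_half_square_le_cos[of "\<alpha> - \<alpha>'"]
  ultimately have "1 - 10 * y \<le> sph \<theta> \<alpha> \<bullet> sph \<theta>' \<alpha>'" using sq by linarith
  then show ?thesis by (simp add: y_def)
qed

text \<open>
  The grid of normals and the heights depending on a balance parameter \<open>t\<close>. Arcs with
  \<open>cos \<theta> > 1 / 4\<close> count as lower and arcs with \<open>cos \<theta> < - 1 / 4\<close> as upper. The bound on \<open>N\<close> makes the mesh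
  at most \<open>1 / 4\<close>, so that a normal close to a point of the upper half space is not on a lower arc, and
  vice versa. The bound on \<open>\<epsilon>\<close> leaves room for the bump in \<open>moment_sign\<close>.
\<close>

locale rolling_grid =
  fixes N :: nat and \<epsilon> :: real
  assumes N: "16 \<le> N" and \<epsilon>: "0 < \<epsilon>" "\<epsilon> \<le> 1 / 10"
begin

definition grid :: "(int \<times> int) set" where
  "grid = {-int N..int N} \<times> {-int N..int N}"

definition lon :: "int \<Rightarrow> real" where "lon j = real_of_int j * pi / N"
definition lat :: "int \<Rightarrow> real" where "lat k = real_of_int k * (pi / 2) / N"

definition normal :: "int \<times> int \<Rightarrow> real^3" where
  "normal i = sph (lon (fst i)) (lat (snd i))"

text \<open>
  The raise is constant along each arc off \<open>G\<close> and vanishes on \<open>G\<close>, so it never increases along a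
  roll. At \<open>t = 1\<close> only the lower arcs are raised, at \<open>t = 0\<close> only the upper ones.
\<close>

definition bulge :: "real \<Rightarrow> int \<times> int \<Rightarrow> real" where
  "bulge t i = (if snd i = 0 then 0 else if 1 / 4 < cos (lon (fst i)) then t
                else if cos (lon (fst i)) < - 1 / 4 then 1 - t else 0)"

text \<open>
  The exponential factor counts the steps \<open>\<bar>j\<bar> + \<bar>k\<bar>\<close> on the way to the bottom normal \<open>(0, 0)\<close>. The gain
  \<open>exp (20 / N\<^sup>2)\<close> per step beats the loss \<open>1 / cos (pi / N)\<close>, as shown in \<open>step_gain\<close>.
\<close>

definition height :: "real \<Rightarrow> int \<times> int \<Rightarrow> real" where
  "height t i = exp (20 * real_of_int (\<bar>fst i\<bar> + \<bar>snd i\<bar>) / (real N)\<^sup>2) * (1 + \<epsilon> * bulge t i)"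

definition body :: "real \<Rightarrow> (real^3) set" where
  "body t = {x. \<forall>i\<in>grid. normal i \<bullet> x \<le> height t i}"

text \<open>
  An upper bound for the circumradius in the absence of any raise: \<open>exp (40 / N)\<close> bounds the factor
  of \<open>2 * N\<close> steps, and the denominator comes from the distance to the nearest normal.
\<close>

definition rad :: real where "rad = exp (40 / N) / (1 - 10 / (real N)\<^sup>2)"

lemma N_sq: "256 \<le> (real N)\<^sup>2" using N power_mono[of 16 "real N" 2] by simp

lemma bulge_bounds: "0 \<le> t \<Longrightarrow> t \<le> 1 \<Longrightarrow> 0 \<le> bulge t i \<and> bulge t i \<le> 1"
  by (simp add: bulge_def)

lemma height_bounds:
  assumes t: "0 \<le> t" "t \<le> 1" and i: "i \<in> grid"
  shows "1 + \<epsilon> * bulge t i \<le> height t i" "height t i \<le> exp (40 / N) * (1 + \<epsilon> * bulge t i)" "1 \<le> height t i"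
proof -
  let ?m = "real_of_int (\<bar>fst i\<bar> + \<bar>snd i\<bar>)"
  have b: "0 \<le> \<epsilon> * bulge t i" using bulge_bounds[OF t] \<epsilon> by simp
  have "\<bar>fst i\<bar> + \<bar>snd i\<bar> \<le> 2 * int N" using i by (auto simp: grid_def)
  then have m: "0 \<le> ?m" "?m \<le> 2 * real N" by linarith+
  have "20 * ?m / (real N)\<^sup>2 \<le> 20 * (2 * real N) / (real N)\<^sup>2" using m by (intro divide_right_mono mult_left_mono) auto
  also have "\<dots> = 40 / N" using N by (simp add: power2_eq_square)
  finally have e2: "exp (20 * ?m / (real N)\<^sup>2) \<le> exp (40 / N)" by simp
  have e1: "1 \<le> exp (20 * ?m / (real N)\<^sup>2)" using m by simp
  show "1 + \<epsilon> * bulge t i \<le> height t i"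
    unfolding height_def using mult_right_mono[OF e1, of "1 + \<epsilon> * bulge t i"] b by simp
  then show "1 \<le> height t i" using b by linarith
  show "height t i \<le> exp (40 / N) * (1 + \<epsilon> * bulge t i)"
    unfolding height_def using b by (intro mult_right_mono e2) auto
qed

lemma step_gain: "\<bar>x\<bar> \<le> pi / N \<Longrightarrow> exp (- (20 / (real N)\<^sup>2)) < cos x"
proof -
  assume "\<bar>x\<bar> \<le> pi / N"
  then have "x\<^sup>2 \<le> (pi / N)\<^sup>2" by (simp add: abs_le_square_iff[symmetric])
  also have "\<dots> \<le> 16 / (real N)\<^sup>2"
    using pi_less_4 power_mono[of pi 4 2] by (auto simp: power_divide intro!: divide_right_mono)
  finally have "1 - 8 / (real N)\<^sup>2 \<le> cos x" using one_minus_half_square_le_cos[of x] by simp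
  moreover have "exp (- (20 / (real N)\<^sup>2)) < 1 - 8 / (real N)\<^sup>2"
  proof -
    define y where "y = 1 / (real N)\<^sup>2"
    have y: "0 < y" "y \<le> 1 / 256" using N_sq N by (auto simp: y_def divide_simps)
    have "1 + 20 * y \<le> exp (20 * y)" by (rule exp_ge_add_one_self)
    moreover have "1 < (1 - 8 * y) * (1 + 20 * y)"
    proof -
      have "y * (160 * y) < y * 12" using y by (intro mult_strict_left_mono) auto
      then show ?thesis by (simp add: algebra_simps)
    qed
    moreover have "0 < 1 - 8 * y" using y by simp
    ultimately have "1 < (1 - 8 * y) * exp (20 * y)"
      by (meson less_le_trans mult_left_mono less_imp_le)
    then have "exp (- (20 * y)) < 1 - 8 * y" by (simp add: exp_minus field_simps)
    then show ?thesis by (simp add: y_def)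
  qed
  ultimately show ?thesis by linarith
qed

lemma norm_normal: "norm (normal i) = 1" by (simp add: normal_def)

text \<open>
  Off \<open>G\<close> the next normal is one step closer to \<open>G\<close> on the same arc, on \<open>G\<close> it is one step closer
  to the bottom.
\<close>

lemma rolls:
  assumes t: "0 \<le> t" "t \<le> 1" and i: "i \<in> grid" "i \<noteq> (0, 0)"
  shows "\<exists>i'\<in>grid. height t i' < height t i * (normal i \<bullet> normal i')"
proof -
  have step: "height t i' < height t i * (normal i \<bullet> normal i')"
    if m: "\<bar>fst i'\<bar> + \<bar>snd i'\<bar> = \<bar>fst i\<bar> + \<bar>snd i\<bar> - 1" and b: "bulge t i' \<le> bulge t i"
      and x: "\<bar>x\<bar> \<le> pi / N" "normal i \<bullet> normal i' = cos x" for i' x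
  proof -
    let ?m = "real_of_int (\<bar>fst i\<bar> + \<bar>snd i\<bar>)"
    have "height t i' = exp (20 * (?m - 1) / (real N)\<^sup>2) * (1 + \<epsilon> * bulge t i')"
      unfolding height_def m by simp
    also have "20 * (?m - 1) / (real N)\<^sup>2 = 20 * ?m / (real N)\<^sup>2 + - (20 / (real N)\<^sup>2)" by (simp add: diff_divide_distrib right_diff_distrib)
    also have "exp (20 * ?m / (real N)\<^sup>2 + - (20 / (real N)\<^sup>2)) * (1 + \<epsilon> * bulge t i')
        \<le> exp (20 * ?m / (real N)\<^sup>2 + - (20 / (real N)\<^sup>2)) * (1 + \<epsilon> * bulge t i)"
      using b \<epsilon> by (intro mult_left_mono add_left_mono) auto
    also have "\<dots> = height t i * exp (- (20 / (real N)\<^sup>2))"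
      unfolding height_def exp_add by (simp only: ac_simps)
    also have "\<dots> < height t i * cos x"
      using step_gain[OF x(1)] height_bounds(3)[OF t i(1)] by (intro mult_strict_left_mono) auto
    finally show ?thesis by (simp add: x(2))
  qed
  obtain j k where jk: "i = (j, k)" by (cases i)
  show ?thesis
  proof (cases "k = 0")
    case False
    define k' where "k' = k - sgn k"
    have k': "\<bar>k'\<bar> = \<bar>k\<bar> - 1" using False by (auto simp: k'_def sgn_if)
    have "\<bar>lat k - lat k'\<bar> = pi / 2 / N"
      using False by (auto simp: lat_def k'_def sgn_if diff_divide_distrib[symmetric] left_diff_distrib[symmetric])
    also have "\<dots> \<le> pi / N" by (intro divide_right_mono) auto
    finally have "\<bar>lat k - lat k'\<bar> \<le> pi / N" .
    moreover have "normal (j, k) \<bullet> normal (j, k') = cos (lat k - lat k')"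
      by (simp add: normal_def inner_sph cos_diff)
    moreover have "bulge t (j, k') \<le> bulge t (j, k)" using t False by (simp add: bulge_def)
    ultimately have "height t (j, k') < height t i * (normal i \<bullet> normal (j, k'))"
      using k' by (intro step) (auto simp: jk)
    moreover have "(j, k') \<in> grid" using i(1) k' by (auto simp: grid_def jk)
    ultimately show ?thesis by blast
  next
    case True
    then have j: "j \<noteq> 0" using i(2) jk by simp
    define j' where "j' = j - sgn j"
    have j': "\<bar>j'\<bar> = \<bar>j\<bar> - 1" using j by (auto simp: j'_def sgn_if)
    have "\<bar>lon j - lon j'\<bar> = pi / N"
      using j by (auto simp: lon_def j'_def sgn_if diff_divide_distrib[symmetric] left_diff_distrib[symmetric])
    moreover have "normal (j, 0) \<bullet> normal (j', 0) = cos (lon j - lon j')"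
      by (simp add: normal_def inner_sph lat_def)
    moreover have "bulge t (j', 0) \<le> bulge t (j, 0)" by (simp add: bulge_def)
    ultimately have "height t (j', 0) < height t i * (normal i \<bullet> normal (j', 0))"
      using j' True by (intro step) (auto simp: jk)
    moreover have "(j', 0) \<in> grid" using i(1) j' by (auto simp: grid_def jk)
    ultimately show ?thesis by blast
  qed
qed

lemma cos_lat_nonneg: "\<bar>k\<bar> \<le> int N \<Longrightarrow> 0 \<le> cos (lat k)"
proof -
  assume "\<bar>k\<bar> \<le> int N"
  then have "\<bar>real_of_int k\<bar> \<le> real N" by linarith
  then have "\<bar>real_of_int k\<bar> * (pi / 2) / N \<le> real N * (pi / 2) / N"
    by (intro divide_right_mono mult_right_mono) auto
  then have "\<bar>lat k\<bar> \<le> pi / 2" using N by (simp add: lat_def abs_mult)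
  then show ?thesis by (intro cos_ge_zero) auto
qed

text \<open>
  Besides being close to \<open>x\<close>, the normal is not on an upper arc if \<open>x\<close> is strictly below the horizontal
  plane, and not on a lower arc if \<open>x\<close> is strictly above it.
\<close>

lemma near_normal:
  obtains i where "i \<in> grid" "(1 - 10 / (real N)\<^sup>2) * norm x \<le> normal i \<bullet> x"
    "0 < x $ 3 \<longrightarrow> cos (lon (fst i)) \<le> 1 / 4" "x $ 3 < 0 \<longrightarrow> - 1 / 4 \<le> cos (lon (fst i))"
proof -
  obtain \<theta> \<alpha> where a: "\<bar>\<theta>\<bar> \<le> pi" "\<bar>\<alpha>\<bar> \<le> pi / 2" "x = norm x *\<^sub>R sph \<theta> \<alpha>" by (rule ex_sph)
  have N0: "0 < N" using N by simp
  obtain j where j: "\<bar>j\<bar> \<le> int N" "\<bar>\<theta> - lon j\<bar> \<le> pi / N"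
    unfolding lon_def by (rule ex_grid_angle[OF N0 _ a(1)]) auto
  obtain k where k: "\<bar>k\<bar> \<le> int N" "\<bar>\<alpha> - lat k\<bar> \<le> pi / 2 / N"
    unfolding lat_def by (rule ex_grid_angle[OF N0 _ a(2)]) auto
  have c0: "0 \<le> cos \<alpha>" using a(2) by (intro cos_ge_zero) auto
  have "1 - 10 / (real N)\<^sup>2 \<le> sph \<theta> \<alpha> \<bullet> normal (j, k)"
    using inner_sph_near[OF j(2) k(2) c0 cos_lat_nonneg[OF k(1)]] N0 by (simp add: normal_def)
  then have "norm x * (1 - 10 / (real N)\<^sup>2) \<le> norm x * (sph \<theta> \<alpha> \<bullet> normal (j, k))"
    by (intro mult_left_mono) auto
  also have "\<dots> = normal (j, k) \<bullet> x"
    using arg_cong[OF a(3), of "\<lambda>z. normal (j, k) \<bullet> z"] by (simp add: inner_commute)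
  finally have near: "(1 - 10 / (real N)\<^sup>2) * norm x \<le> normal (j, k) \<bullet> x" by (simp add: mult.commute)
  have x3: "x $ 3 = - (norm x * cos \<alpha>) * cos \<theta>"
    using arg_cong[OF a(3), of "\<lambda>z. z $ 3"] by (simp add: sph_def)
  have nc: "0 \<le> norm x * cos \<alpha>" using c0 by simp
  have "pi / N \<le> 1 / 4" using N pi_less_4 by (simp add: field_simps)
  then have cc: "cos (lon j) - cos \<theta> \<le> 1 / 4" "cos \<theta> - cos (lon j) \<le> 1 / 4"
    using cos_diff_le[of "lon j" \<theta>] cos_diff_le[of \<theta> "lon j"] j(2) abs_minus_commute[of \<theta> "lon j"]
    by linarith+
  show ?thesis
  proof (rule that[of "(j, k)"])
    show "(j, k) \<in> grid" using j k by (auto simp: grid_def)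
    have "cos \<theta> < 0" if "0 < x $ 3" using that nc c0 unfolding x3 by (auto simp: mult_less_0_iff)
    then show "0 < x $ 3 \<longrightarrow> cos (lon (fst (j, k))) \<le> 1 / 4" using cc by auto
    have "0 < cos \<theta>" if "x $ 3 < 0" using that nc c0 unfolding x3 by (auto simp: zero_less_mult_iff)
    then show "x $ 3 < 0 \<longrightarrow> - 1 / 4 \<le> cos (lon (fst (j, k)))" using cc by auto
  qed (rule near)
qed

lemma norm_le_of_height_le:
  assumes "(1 - 10 / (real N)\<^sup>2) * norm x \<le> normal i \<bullet> x" "normal i \<bullet> x \<le> exp (40 / N) * c"
  shows "norm x \<le> rad * c"
proof -
  have "0 < 1 - 10 / (real N)\<^sup>2" using N_sq N by (simp add: field_simps)
  then show ?thesis using assms by (simp add: rad_def field_simps)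
qed

lemma rad_ge_1: "1 \<le> rad"
proof -
  have "0 < 1 - 10 / (real N)\<^sup>2" using N_sq N by (simp add: field_simps)
  moreover have "1 * (1 - 10 / (real N)\<^sup>2) \<le> 1" by simp
  then have "1 * (1 - 10 / (real N)\<^sup>2) \<le> exp (40 / real N)" by (rule order_trans) simp
  ultimately show ?thesis unfolding rad_def by (simp only: pos_le_divide_eq)
qed

lemma body_bounds:
  assumes t: "0 \<le> t" "t \<le> 1"
  shows "cball 0 1 \<subseteq> body t" "body t \<subseteq> cball 0 (rad * (1 + \<epsilon>))"
proof -
  show "cball 0 1 \<subseteq> body t"
  proof
    fix x :: "real^3" assume "x \<in> cball 0 1"
    then have "normal i \<bullet> x \<le> 1" for i
      unfolding normal_def by (intro order_trans[OF inner_sph_le]) simp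
    then have "normal i \<bullet> x \<le> height t i" if "i \<in> grid" for i
      using height_bounds(3)[OF t that] by (rule order_trans)
    then show "x \<in> body t" by (simp add: body_def)
  qed
  show "body t \<subseteq> cball 0 (rad * (1 + \<epsilon>))"
  proof
    fix x assume x: "x \<in> body t"
    obtain i where i: "i \<in> grid" "(1 - 10 / (real N)\<^sup>2) * norm x \<le> normal i \<bullet> x" by (rule near_normal[of x])
    have "normal i \<bullet> x \<le> height t i" using x i by (simp add: body_def)
    also have "\<dots> \<le> exp (40 / N) * (1 + \<epsilon> * bulge t i)" by (rule height_bounds(2)[OF t i(1)])
    also have "\<dots> \<le> exp (40 / N) * (1 + \<epsilon>)" using bulge_bounds[OF t, of i] \<epsilon> by simp
    finally show "x \<in> cball 0 (rad * (1 + \<epsilon>))" using norm_le_of_height_le[OF i(2)] by simp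
  qed
qed

lemma finite_grid: "finite grid" by (simp add: grid_def)

lemma compact_body: "0 \<le> t \<Longrightarrow> t \<le> 1 \<Longrightarrow> compact (body t)"
proof -
  assume t: "0 \<le> t" "t \<le> 1"
  have "body t = (\<Inter>i\<in>grid. {x. normal i \<bullet> x \<le> height t i})" by (auto simp: body_def)
  then have "closed (body t)" by (auto intro!: closed_INT closed_halfspace_le)
  then show ?thesis using body_bounds(2)[OF t] bounded_cball bounded_subset compact_eq_bounded_closed by blast
qed

text \<open>
  The reflections in the first and second coordinates act on the grid as \<open>j \<mapsto> - j\<close> and
  \<open>k \<mapsto> - k\<close>, and neither changes the heights.
\<close>

lemma horizontal_moments_eq_0:
  assumes t: "0 \<le> t" "t \<le> 1"
  shows "(LINT x:body t|lborel. x \<bullet> axis 1 1) = 0" "(LINT x:body t|lborel. x \<bullet> axis 2 1) = 0"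
proof -
  define c where "c m j = (if j = axis m 1 then -1 else 1 :: real)" for m :: 3 and j :: "real^3"
  have flip: "sign_flip (c m) x $ n = (if n = m then - x $ n else x $ n)" for m n :: 3 and x
    using inner_sign_flip[of "axis n 1" "c m" x] by (simp add: inner_axis c_def axis_eq_axis axis_in_Basis_iff)
  have mom: "(LINT x:body t|lborel. x \<bullet> axis m 1) = 0"
    if inv: "\<And>i x. normal i \<bullet> sign_flip (c m) x = normal (\<tau> i) \<bullet> x"
      and \<tau>: "\<And>i. height t (\<tau> i) = height t i" "\<And>i. i \<in> grid \<Longrightarrow> \<tau> i \<in> grid" for m \<tau>
  proof (rule moment_eq_0_if_symmetric[where c = "c m"])
    show "sign_flip (c m) x \<in> body t" if "x \<in> body t" for x
      using that \<tau>(2) unfolding body_def mem_Collect_eq inv by (metis \<tau>(1))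
  qed (auto simp: c_def axis_in_Basis_iff intro: borel_compact[OF compact_body[OF t]])
  show "(LINT x:body t|lborel. x \<bullet> axis 1 1) = 0"
    by (rule mom[where \<tau> = "\<lambda>(j, k). (- j, k)"])
      (auto simp: normal_def inner_sph_vector flip lon_def height_def bulge_def grid_def)
  show "(LINT x:body t|lborel. x \<bullet> axis 2 1) = 0"
    by (rule mom[where \<tau> = "\<lambda>(j, k). (j, - k)"])
      (auto simp: normal_def inner_sph_vector flip lat_def height_def bulge_def grid_def)
qed

lemma continuous_moment: "continuous_on {0..1} (\<lambda>t. LINT x:body t|lborel. x \<bullet> b)"
proof (rule continuous_on_moment_polyhedron[where I = grid and a = normal and h = height])
  show "normal i \<noteq> 0" for i using norm_normal[of i] by auto
  show "continuous_on {0..1} (\<lambda>t. height t i)" for i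
  proof -
    have "continuous_on {0..1} (\<lambda>t. bulge t i)"
      by (cases "snd i = 0"; cases "1 / 4 < cos (lon (fst i))"; cases "cos (lon (fst i)) < - 1 / 4")
        (auto simp: bulge_def intro!: continuous_intros)
    then show ?thesis unfolding height_def by (intro continuous_intros)
  qed
  show "body t \<subseteq> cball 0 (rad * (1 + \<epsilon>))" if "t \<in> {0..1}" for t
    using body_bounds(2)[of t] that by simp
qed (auto simp: finite_grid body_def)

text \<open>
  Here \<open>\<sigma>\<close> selects the case: for \<open>\<sigma> = 1\<close> the lower arcs are raised and the body is bottom-heavy, for
  \<open>\<sigma> = -1\<close> the roles of top and bottom are exchanged. The bump is a ball of radius
  \<open>\<epsilon> / 4\<close> around a point \<open>p\<close> at distance \<open>1 + \<epsilon> / 2\<close> from the origin. It reaches at most to the height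
  \<open>1 + 3 * \<epsilon> / 4\<close>, which the raised arcs permit; the direction of \<open>p\<close> is far enough from \<open>G\<close> and from
  the arcs that are not raised for their constraints, of height at least \<open>1\<close>, to hold as well.
  On the opposite side nothing is raised and the body stays within radius \<open>rad\<close>.
\<close>

lemma moment_sign:
  assumes \<sigma>: "\<sigma> = 1 \<and> t = 1 \<or> \<sigma> = -1 \<and> t = 0" and rad: "rad \<le> 2" "4 * (rad ^ 3 - 1) < (\<epsilon> / 4) ^ 3"
  shows "0 < (LINT x:body t|lborel. x \<bullet> axis 3 (- \<sigma>))"
proof -
  \<comment> \<open>a rational unit vector of elevation between \<open>0\<close> and \<open>pi / 2\<close>, on the side selected by \<open>\<sigma>\<close>\<close>
  define q :: "real^3" where "q = vector [0, 3 / 5, - \<sigma> * 4 / 5]"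
  define p where "p = (1 + \<epsilon> / 2) *\<^sub>R q"
  have t: "0 \<le> t" "t \<le> 1" and \<sigma>2: "\<sigma> * \<sigma> = 1" using \<sigma> by auto
  have "q \<bullet> q = 1" using \<sigma>2 by (simp add: q_def inner_vec_def sum_3)
  then have nq: "norm q = 1" by (simp add: norm_eq_1)
  then have np: "norm p = 1 + \<epsilon> / 2" using \<epsilon> by (simp add: p_def)
  have near: "a \<bullet> x \<le> a \<bullet> p + \<epsilon> / 4" if "x \<in> cball p (\<epsilon> / 4)" "norm a = 1" for a x
  proof -
    have "a \<bullet> (x - p) \<le> norm (x - p)" using Cauchy_Schwarz_ineq2[of a "x - p"] that(2) by simp
    then show ?thesis using that(1) by (simp add: inner_diff_right dist_norm norm_minus_commute)
  qed
  have sub: "cball p (\<epsilon> / 4) \<subseteq> body t"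
  proof
    fix x assume x: "x \<in> cball p (\<epsilon> / 4)"
    have "normal i \<bullet> x \<le> height t i" if i: "i \<in> grid" for i
    proof -
      obtain j k where jk: "i = (j, k)" by (cases i)
      have cl: "0 \<le> cos (lat k)" using cos_lat_nonneg[of k] i by (auto simp: grid_def jk)
      have nx: "normal i \<bullet> x \<le> (1 + \<epsilon> / 2) * (normal i \<bullet> q) + \<epsilon> / 4"
        using near[OF x norm_normal[of i]] by (simp add: p_def)
      show ?thesis
      proof (cases "k \<noteq> 0 \<and> 1 / 4 < \<sigma> * cos (lon j)")
        case True
        then have "bulge t i = 1" using \<sigma> by (auto simp: bulge_def jk)
        then have "1 + \<epsilon> \<le> height t i" using height_bounds(1)[OF t i] by simp
        have "normal i \<bullet> q \<le> 1" unfolding normal_def using inner_sph_le nq by metis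
        then have "(1 + \<epsilon> / 2) * (normal i \<bullet> q) + \<epsilon> / 4 \<le> (1 + \<epsilon> / 2) * 1 + \<epsilon> / 4"
          using \<epsilon> by (intro mult_left_mono add_right_mono) auto
        also have "\<dots> \<le> height t i" using \<open>1 + \<epsilon> \<le> height t i\<close> \<epsilon> by simp
        finally show ?thesis by (rule order_trans[OF nx])
      next
        case False
        have nq: "normal i \<bullet> q = 3 / 5 * sin (lat k) + 4 / 5 * (cos (lat k) * (\<sigma> * cos (lon j)))"
          by (simp add: normal_def inner_sph_vector q_def jk algebra_simps)
        have "normal i \<bullet> q \<le> 4 / 5"
        proof (cases "k = 0")
          case True
          have "\<sigma> * cos (lon j) \<le> 1" using \<sigma> cos_ge_minus_one[of "lon j"] cos_le_one[of "lon j"] by (elim disjE conjE) simp_all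
          then show ?thesis using True by (simp add: nq lat_def)
        next
          case k: False
          then have "cos (lat k) * (\<sigma> * cos (lon j)) \<le> cos (lat k) * (1 / 4)"
            using False cl by (intro mult_left_mono) auto
          also have "\<dots> \<le> 1 / 4" by simp
          finally show ?thesis using sin_le_one[of "lat k"] unfolding nq by linarith
        qed
        then have "(1 + \<epsilon> / 2) * (normal i \<bullet> q) + \<epsilon> / 4 \<le> (1 + \<epsilon> / 2) * (4 / 5) + \<epsilon> / 4"
          using \<epsilon> by (intro mult_left_mono add_right_mono) auto
        also have "\<dots> \<le> 1" using \<epsilon> by (simp add: field_simps)
        also have "\<dots> \<le> height t i" using height_bounds(3)[OF t i] .
        finally show ?thesis by (rule order_trans[OF nx])
      qed
    qed
    then show "x \<in> body t" by (simp add: body_def)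
  qed
  have disj: "cball p (\<epsilon> / 4) \<inter> cball 0 1 = {}"
  proof -
    have "norm p \<le> dist p x + norm x" for x using norm_triangle_sub[of p x] by (simp add: dist_norm)
    then have tri: "1 + \<epsilon> / 2 \<le> dist p x + norm x" for x by (simp only: np)
    then have away: "\<epsilon> / 4 < dist p x" if "norm x \<le> 1" for x
    proof -
      have "1 + \<epsilon> / 2 \<le> dist p x + 1" using tri[of x] that by linarith
      then show ?thesis using \<epsilon>(1) by simp
    qed
    show ?thesis
    proof (rule equals0I)
      fix x assume "x \<in> cball p (\<epsilon> / 4) \<inter> cball 0 1"
      then have "dist p x \<le> \<epsilon> / 4" "norm x \<le> 1" by auto
      then show False using away[of x] by linarith
    qed
  qed
  have up: "1 / 2 \<le> x \<bullet> axis 3 (- \<sigma>)" if "x \<in> cball p (\<epsilon> / 4)" for x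
  proof -
    have "norm (axis 3 \<sigma> :: real^3) = 1" by (simp add: norm_eq_1 inner_axis_axis \<sigma>2)
    then have "axis 3 \<sigma> \<bullet> x \<le> axis 3 \<sigma> \<bullet> p + \<epsilon> / 4" by (rule near[OF that])
    also have "axis 3 \<sigma> \<bullet> p = - ((1 + \<epsilon> / 2) * (4 / 5))"
      using \<sigma>2 by (simp add: inner_axis' p_def q_def)
    also have "- ((1 + \<epsilon> / 2) * (4 / 5)) + \<epsilon> / 4 \<le> - (1 / 2)" using \<epsilon> by (simp add: field_simps)
    finally show ?thesis by (simp add: inner_axis inner_axis' mult.commute)
  qed
  have low: "norm x \<le> rad" if x: "x \<in> body t" "x \<bullet> axis 3 (- \<sigma>) < 0" for x
  proof -
    obtain i where i: "i \<in> grid" "(1 - 10 / (real N)\<^sup>2) * norm x \<le> normal i \<bullet> x"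
        "0 < x $ 3 \<longrightarrow> cos (lon (fst i)) \<le> 1 / 4" "x $ 3 < 0 \<longrightarrow> - 1 / 4 \<le> cos (lon (fst i))"
      by (rule near_normal[of x])
    from \<sigma> have flat: "bulge t i = 0"
    proof (elim disjE conjE)
      assume "\<sigma> = 1" "t = 1"
      then have "0 < x $ 3" using x(2) by (simp add: inner_axis)
      with i(3) show ?thesis by (simp add: bulge_def \<open>t = 1\<close>)
    next
      assume "\<sigma> = - 1" "t = 0"
      then have "x $ 3 < 0" using x(2) by (simp add: inner_axis)
      with i(4) show ?thesis by (simp add: bulge_def \<open>t = 0\<close>)
    qed
    have "normal i \<bullet> x \<le> height t i" using x(1) i(1) by (simp add: body_def)
    also have "\<dots> \<le> exp (40 / N) * 1" using height_bounds(2)[OF t i(1)] flat by simp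
    finally have "norm x \<le> rad * 1" by (rule norm_le_of_height_le[OF i(2)])
    then show ?thesis by simp
  qed
  have unit: "norm (axis 3 (- \<sigma>) :: real^3) = 1" by (simp add: norm_eq_1 inner_axis_axis \<sigma>2)
  have small: "4 * (rad ^ DIM(real^3) - 1) < (\<epsilon> / 4) ^ DIM(real^3)" using rad(2) by simp
  have r: "0 < \<epsilon> / 4" using \<epsilon>(1) by simp
  show ?thesis
    by (rule moment_pos_if_bump[OF compact_body[OF t] body_bounds(1)[OF t] sub disj up r unit low rad_ge_1 rad(1) small])
qed

text \<open>
  As \<open>t\<close> goes from \<open>0\<close> to \<open>1\<close> the vertical moment changes sign, while the rolling conditions hold for
  every \<open>t\<close>.
\<close>

lemma ex_monostable:
  assumes rad: "rad \<le> 2" "4 * (rad ^ 3 - 1) < (\<epsilon> / 4) ^ 3"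
  shows "\<exists>P. monostable P \<and> cball 0 1 \<subseteq> P \<and> P \<subseteq> cball 0 (rad * (1 + \<epsilon>))"
proof -
  let ?Z = "\<lambda>t. LINT x:body t|lborel. x \<bullet> axis 3 1"
  have "0 < ?Z 0" using moment_sign[of "-1" 0] rad by simp
  moreover have "?Z 1 < 0"
  proof -
    have "axis 3 (- 1) = - (axis 3 1 :: real^3)" by (simp add: axis_def vec_eq_iff)
    then show ?thesis using moment_sign[of 1 1] rad by (simp add: set_lebesgue_integral_def)
  qed
  ultimately obtain t where t: "0 \<le> t" "t \<le> 1" "?Z t = 0"
    using IVT2'[of ?Z 1 0 0, OF _ _ _ continuous_moment] by auto
  have "(LINT x:body t|lborel. x \<bullet> b) = 0" if "b \<in> Basis" for b
    using that horizontal_moments_eq_0[OF t(1,2)] t(3) by (auto simp: Basis_vec_def UNIV_3)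
  then have "center_of_mass (body t) = 0"
    by (rule center_of_mass_eq_0_if_moments[OF compact_body[OF t(1,2)]])
  then have "monostable (body t)"
  proof (intro monostable_if_all_but_one_face_roll[where I = grid and a = normal and h = "height t"])
    show "0 < height t i" if "i \<in> grid" for i using height_bounds(3)[OF t(1,2) that] by simp
    show "bounded (body t)" using compact_body[OF t(1,2)] by (rule compact_imp_bounded)
    show "(0, 0) \<in> grid" by (simp add: grid_def)
  qed (use rolls[OF t(1,2)] in \<open>simp_all add: finite_grid norm_normal body_def\<close>)
  then show ?thesis using body_bounds[OF t(1,2)] by blast
qed

end

lemma ex_monostable_near_ball:
  assumes "0 < \<delta>"
  shows "\<exists>P. monostable P \<and> cball 0 1 \<subseteq> P \<and> P \<subseteq> cball 0 (1 + \<delta>)"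
proof -
  define \<epsilon> where "\<epsilon> = min (1 / 10) (\<delta> / 2)"
  have \<epsilon>: "0 < \<epsilon>" "\<epsilon> \<le> 1 / 10" "\<epsilon> < \<delta>" using assms by (auto simp: \<epsilon>_def)
  let ?r = "\<lambda>N::nat. exp (40 / real N) / (1 - 10 / (real N)\<^sup>2)"
  have "(\<lambda>N. exp (40 / real N) / (1 - 10 / real N * (1 / real N))) \<longlonglongrightarrow> exp 0 / (1 - 0 * 0)"
    by (intro tendsto_intros lim_const_over_n) auto
  then have lim: "?r \<longlonglongrightarrow> 1" by (simp add: power2_eq_square)
  have "(\<lambda>N. ?r N * (1 + \<epsilon>)) \<longlonglongrightarrow> 1 * (1 + \<epsilon>)" by (intro tendsto_intros lim)
  then have "\<forall>\<^sub>F N in sequentially. ?r N * (1 + \<epsilon>) < 1 + \<delta>"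
    by (rule order_tendstoD) (use \<epsilon> in simp)
  moreover have "(\<lambda>N. 4 * (?r N ^ 3 - 1)) \<longlonglongrightarrow> 4 * (1 ^ 3 - 1)" by (intro tendsto_intros lim)
  then have "\<forall>\<^sub>F N in sequentially. 4 * (?r N ^ 3 - 1) < (\<epsilon> / 4) ^ 3"
    by (rule order_tendstoD) (use \<epsilon> in simp)
  moreover have "\<forall>\<^sub>F N in sequentially. ?r N < 2" by (rule order_tendstoD(2)[OF lim]) simp
  moreover have "\<forall>\<^sub>F N in sequentially. 16 \<le> N" by (rule eventually_ge_at_top)
  ultimately have "\<forall>\<^sub>F N in sequentially. 16 \<le> N \<and> ?r N < 2 \<and> 4 * (?r N ^ 3 - 1) < (\<epsilon> / 4) ^ 3
      \<and> ?r N * (1 + \<epsilon>) < 1 + \<delta>"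
    by eventually_elim simp
  from eventually_happens'[OF sequentially_bot this]
  obtain N where large: "16 \<le> N" "?r N < 2" "4 * (?r N ^ 3 - 1) < (\<epsilon> / 4) ^ 3" "?r N * (1 + \<epsilon>) < 1 + \<delta>"
    by (elim exE conjE)
  interpret rolling_grid N \<epsilon> by unfold_locales (use large \<epsilon> in auto)
  have "rad \<le> 2" using large(2) unfolding rad_def by (rule less_imp_le)
  moreover have "4 * (rad ^ 3 - 1) < (\<epsilon> / 4) ^ 3" using large(3) unfolding rad_def .
  ultimately obtain P where P: "monostable P" "cball 0 1 \<subseteq> P" "P \<subseteq> cball 0 (rad * (1 + \<epsilon>))"
    using ex_monostable by blast
  have "cball (0::real^3) (rad * (1 + \<epsilon>)) \<subseteq> cball 0 (1 + \<delta>)"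
    using large(4) by (intro subset_cball) (simp add: rad_def)
  then show ?thesis using P by blast
qed

section \<open>The infimum of diameter over girth\<close>

lemma inverse_pi_le_diameter_girth_ratio:
  assumes "monostable P"
  shows "1 / pi \<le> diameter P / girth P"
proof -
  have P: "convex P" "compact P" "interior P \<noteq> {}"
    using assms by (auto simp: monostable_def convex_polyhedron_def convex_body_def)
  then obtain c where "c \<in> interior P" by blast
  then obtain r where r: "0 < r" "cball c r \<subseteq> P" unfolding mem_interior_cball by blast
  note g = girth_bounds[OF P(1,2) r(2,1)]
  have "0 < 2 * pi * r" using r by simp
  then have "0 < girth P" using g(1) by linarith
  then show ?thesis using g(2) by (simp add: field_simps)
qed

lemma diameter_girth_ratio_le:
  assumes P: "monostable P" "cball 0 1 \<subseteq> P" "P \<subseteq> cball 0 (1 + \<delta>)" and \<delta>: "0 < \<delta>"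
  shows "diameter P / girth P \<le> (1 + \<delta>) / pi"
proof -
  have "convex P" "compact P"
    using P(1) by (auto simp: monostable_def convex_polyhedron_def convex_body_def)
  then have g: "2 * pi * 1 \<le> girth P" using P(2) by (intro girth_bounds(1)[where c = 0]) auto
  have d: "diameter P \<le> 2 * (1 + \<delta>)"
    using diameter_subset[OF P(3)] \<delta> by simp
  have "diameter P / girth P \<le> 2 * (1 + \<delta>) / (2 * pi * 1)"
    using d g \<delta> by (intro frac_le) auto
  also have "\<dots> = (1 + \<delta>) / pi" by (simp add: field_simps)
  finally show ?thesis .
qed

theorem corollary1:
  fixes S :: "real set"
  defines "S \<equiv> {diameter P / girth P | P :: (real^3) set. monostable P}"
  shows "S \<noteq> {} \<and> bdd_below S \<and> Inf S = 1 / pi"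
proof -
  have low: "1 / pi \<le> s" if "s \<in> S" for s
    using that inverse_pi_le_diameter_girth_ratio by (auto simp: S_def)
  have up: "\<exists>s\<in>S. s \<le> 1 / pi + e" if e: "0 < e" for e
  proof -
    have \<delta>: "0 < e * pi" using e by simp
    obtain P :: "(real^3) set" where P: "monostable P" "cball 0 1 \<subseteq> P" "P \<subseteq> cball 0 (1 + e * pi)"
      using ex_monostable_near_ball[OF \<delta>] by blast
    have "diameter P / girth P \<le> 1 / pi + e"
      using diameter_girth_ratio_le[OF P \<delta>] by (simp add: add_divide_distrib)
    then show ?thesis using P(1) unfolding S_def by blast
  qed
  have ne: "S \<noteq> {}" using up[of 1] by auto
  have bdd: "bdd_below S" using low by (intro bdd_belowI)
  have "Inf S \<le> 1 / pi"
  proof (rule field_le_epsilon)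
    fix e :: real assume "0 < e"
    then obtain s where "s \<in> S" "s \<le> 1 / pi + e" using up by blast
    then show "Inf S \<le> 1 / pi + e" using cInf_lower[OF _ bdd] by force
  qed
  moreover have "1 / pi \<le> Inf S" using ne low by (intro cInf_greatest)
  ultimately show ?thesis using ne bdd by simp
qed

end
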